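(* Let $i\in\mathbb{N}_0$ and let $\alpha,\beta\in\mathbb{C}$. Then $$F^{1:1;3}_{1:0;2}\left[\begin{matrix}\alpha: & \alpha+\beta-i\,; & i-\alpha,\ 1+\tfrac12\alpha,\ \tfrac{\alpha-\beta}{2}\,;\\ \beta: & -\,; & \tfrac12\alpha,\ 1+\tfrac{\alpha+\beta}{2}\,;\end{matrix}\ -1,\ -1\right] =\frac{\Gamma(-\alpha)\,\Gamma\!\left(1+\frac{\alpha+\beta}{2}\right)}{\Gamma(i-\alpha)\,\Gamma\!\left(\frac12\beta+\frac32\alpha-i+1\right)}\sum_{r=0}^{i}(-1)^r\binom{i}{r}\frac{\Gamma\!\left(\frac14\beta+\frac34\alpha+\frac{r+1-i}{2}\right)}{\Gamma\!\left(\frac14\beta-\frac14\alpha+\frac{r+1-i}{2}\right)}$$ and $$F^{1:1;3}_{1:0;2}\left[\begin{matrix}\alpha: & \alpha+\beta+i\,; & -\alpha-i,\ 1+\tfrac12\alpha,\ \tfrac{\alpha-\beta}{2}\,;\\ \beta: & -\,; & \tfrac12\alpha,\ 1+\tfrac{\alpha+\beta}{2}\,;\end{matrix}\ -1,\ -1\right] =\frac{\Gamma\!\left(1+\frac{\alpha+\beta}{2}\right)}{\Gamma\!\left(\frac12\beta+\frac32\alpha+i+1\right)}\sum_{r=0}^{i}\binom{i}{r}\frac{\Gamma\!\left(\frac14\beta+\frac34\alpha+\frac{r+1+i}{2}\right)}{\Gamma\!\left(\frac14\beta-\frac14\alpha+\frac{r+1-i}{2}\right)}.$$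
   Context: For $\lambda\in\mathbb{C}$ and $n\in\mathbb{N}_0$, $(\lambda)_0=1$ and $(\lambda)_n=\lambda(\lambda+1)\cdots(\lambda+n-1)$; $\Gamma$ is Euler's Gamma function and $\binom{i}{r}$ the binomial coefficient. The (generalized) Kampé de Fériet function is defined by $$F^{H:A;B}_{G:C;D}\left[\begin{matrix}(h_H): & (a_A)\,; & (b_B)\,;\\ (g_G): & (c_C)\,; & (d_D)\,;\end{matrix}\ x,\ y\right]=\sum_{m=0}^\infty\sum_{n=0}^\infty\frac{\prod_{j=1}^H(h_j)_{m+n}\prod_{j=1}^A(a_j)_m\prod_{j=1}^B(b_j)_n}{\prod_{j=1}^G(g_j)_{m+n}\prod_{j=1}^C(c_j)_m\prod_{j=1}^D(d_j)_n}\frac{x^m}{m!}\frac{y^n}{n!},$$ where a dash "$-$" denotes an empty list of parameters (empty products equal $1$). Parameters are tacitly assumed to be such that the double series converges, no denominator parameter is a non-positive integer, and all Gamma values appearing are finite. *)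

theory Defs
  imports "HOL-Analysis.Analysis"
begin

text \<open>General term of the Kampe de Feriet double series; parameter lists are given as
  Isabelle lists (the empty list plays the role of the dash).\<close>
definition kdf_term ::
  "complex list \<Rightarrow> complex list \<Rightarrow> complex list \<Rightarrow> complex list \<Rightarrow> complex list \<Rightarrow> complex list
   \<Rightarrow> complex \<Rightarrow> complex \<Rightarrow> nat \<Rightarrow> nat \<Rightarrow> complex" where
  "kdf_term hs as bs gs cs ds x y m n =
     ((\<Prod>h\<leftarrow>hs. pochhammer h (m + n)) * (\<Prod>a\<leftarrow>as. pochhammer a m) * (\<Prod>b\<leftarrow>bs. pochhammer b n)) /
     ((\<Prod>g\<leftarrow>gs. pochhammer g (m + n)) * (\<Prod>c\<leftarrow>cs. pochhammer c m) * (\<Prod>d\<leftarrow>ds. pochhammer d n))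
     * (x ^ m / fact m) * (y ^ n / fact n)"

definition KdF ::
  "complex list \<Rightarrow> complex list \<Rightarrow> complex list \<Rightarrow> complex list \<Rightarrow> complex list \<Rightarrow> complex list
   \<Rightarrow> complex \<Rightarrow> complex \<Rightarrow> complex" where
  "KdF hs as bs gs cs ds x y = (\<Sum>m. \<Sum>n. kdf_term hs as bs gs cs ds x y m n)"

definition KdF_converges ::
  "complex list \<Rightarrow> complex list \<Rightarrow> complex list \<Rightarrow> complex list \<Rightarrow> complex list \<Rightarrow> complex list
   \<Rightarrow> complex \<Rightarrow> complex \<Rightarrow> bool" where
  "KdF_converges hs as bs gs cs ds x y \<longleftrightarrow>
     (\<forall>m. summable (\<lambda>n. kdf_term hs as bs gs cs ds x y m n)) \<and>
     summable (\<lambda>m. \<Sum>n. kdf_term hs as bs gs cs ds x y m n)"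

end

theory Submission
  imports Defs "HOL-Complex_Analysis.Complex_Analysis"
begin

text \<open>
  Write \<open>b\<close> for the parameter \<open>\<plusminus>i - \<alpha>\<close> of the \<open>n\<close>-series, so that the parameter of the
  \<open>m\<close>-series is \<open>\<beta> - b\<close>, and put \<open>c = 1 + (\<alpha> + \<beta>)/2\<close>.
  Let \<open>\<Phi>(x, y)\<close> be the series with arguments \<open>-x\<close>, \<open>-y\<close>. On the diagonal, two applications of
  Vandermonde's identity collapse the coefficients and Pfaff's transformation gives
  \<open>\<Phi>(x, x) = (1 + x) powr (-\<alpha>) * F(b, 1 + \<alpha>; c; x/(1 + x))\<close> for \<open>x < 1\<close>.

  The iterated series at \<open>(1, 1)\<close> need not converge absolutely. Pfaff's transformation of the inner
  \<open>m\<close>-series writes \<open>\<Phi>(x, y)\<close> as \<open>(1 + x) powr (b - \<beta>) * (\<Sum>n. e\<^sub>n y\<^sup>n g\<^sub>n(x))\<close>, where \<open>\<Sum>n. e\<^sub>n\<close> is the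
  row \<open>m = 0\<close> of the double series and \<open>g\<^sub>n\<close> has uniformly bounded variation in \<open>n\<close>. So convergence of that single
  row makes \<open>\<Phi>\<close> continuous on the closed unit square, and by Abel's theorem the iterated sum is
  \<open>\<Phi>(1, 1) = 2 powr (-\<alpha>) * F(b, 1 + \<alpha>; c; 1/2)\<close>.

  For \<open>i = 0\<close> this is Bailey's summation at \<open>1/2\<close>, proved here from a two-step recurrence in
  \<open>c\<close> and the limit \<open>c \<rightarrow> \<infinity>\<close>. Contiguous relations together with Pascal's rule give all \<open>i\<close>.
\<close>

section \<open>Series and Pfaff's transformation\<close>

text \<open>The quotient \<open>R\<close> is an explicit sequence linked to \<open>f\<close> only
  eventually, so finitely many vanishing denominators, such as \<open>c + of_nat k = 0\<close>, do
  no harm.\<close>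

lemma summable_norm_ratio_limit:
  fixes f R :: "nat \<Rightarrow> 'a :: real_normed_field"
  assumes step: "eventually (\<lambda>k. f (Suc k) = f k * R k) sequentially"
    and lim: "R \<longlonglongrightarrow> L" and "norm L < 1"
  shows "summable (\<lambda>k. norm (f k))"
proof -
  obtain r where r: "norm L < r" "r < 1" using assms(3) dense by blast
  have "eventually (\<lambda>k. norm (R k) < r) sequentially"
    using order_tendstoD(2)[OF tendsto_norm[OF lim] r(1)] .
  with step have "eventually (\<lambda>k. norm (f (Suc k)) \<le> r * norm (f k)) sequentially"
  proof eventually_elim
    case (elim k)
    then show ?case
      by (simp add: norm_mult mult.commute[of "norm (f k)"] mult_right_mono)
  qed
  then obtain N where "\<And>k. k \<ge> N \<Longrightarrow> norm (f (Suc k)) \<le> r * norm (f k)"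
    by (auto simp: eventually_sequentially)
  then show ?thesis
    by (intro summable_ratio_test[OF r(2), of N]) auto
qed

lemma shifted_ratio_tendsto_1:
  fixes a c :: "'a :: real_normed_field"
  shows "(\<lambda>k. (a + of_nat k) / (c + of_nat k)) \<longlonglongrightarrow> 1"
proof -
  have inf: "filterlim (\<lambda>k. c + of_nat k :: 'a) at_infinity sequentially"
    by (intro tendsto_add_filterlim_at_infinity[OF tendsto_const] tendsto_of_nat)
  have "(\<lambda>k. 1 + (a - c) / (c + of_nat k)) \<longlonglongrightarrow> 1 + 0"
    by (intro tendsto_intros tendsto_divide_0[OF tendsto_const] inf)
  moreover have "eventually (\<lambda>k. c + of_nat k \<noteq> 0) sequentially"
    using inf by (simp add: filterlim_at_infinity_imp_eventually_ne)
  then have "eventually (\<lambda>k. 1 + (a - c) / (c + of_nat k) = (a + of_nat k) / (c + of_nat k)) sequentially"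
    by eventually_elim (simp add: field_simps)
  ultimately show ?thesis
    by (simp add: tendsto_cong)
qed

lemma nonpos_Ints_add_of_nat_neq_0:
  fixes c :: "'a :: ring_char_0"
  assumes "c \<notin> \<int>\<^sub>\<le>\<^sub>0"
  shows "c + of_nat k \<noteq> 0"
  using assms by (metis add_eq_0_iff2 minus_of_nat_in_nonpos_Ints)

lemma nonpos_Ints_add_of_nat:
  fixes c :: "'a :: ring_1"
  assumes "c \<notin> \<int>\<^sub>\<le>\<^sub>0"
  shows "c + of_nat n \<notin> \<int>\<^sub>\<le>\<^sub>0"
  using assms by (metis nonpos_Ints_diff_Nats add_diff_cancel_right' of_nat_in_Nats)

lemma pochhammer_nonzero:
  fixes c :: "'a :: field_char_0"
  assumes "c \<notin> \<int>\<^sub>\<le>\<^sub>0"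
  shows "pochhammer c k \<noteq> 0"
  using assms by (auto simp: pochhammer_eq_0_iff)

lemma norm_pochhammer_le:
  fixes a :: "'a :: real_normed_field"
  shows "norm (pochhammer a n) \<le> pochhammer (norm a) n"
proof (induction n)
  case (Suc n)
  have "norm (a + of_nat n) \<le> norm a + of_nat n"
    using norm_triangle_ineq[of a "of_nat n"] by simp
  then have "norm (pochhammer a n) * norm (a + of_nat n) \<le> pochhammer (norm a) n * (norm a + of_nat n)"
    using Suc by (intro mult_mono) (auto intro: order_trans[OF norm_ge_zero])
  then show ?case
    by (simp add: pochhammer_Suc norm_mult)
qed simp

lemma summable_norm_hypergeometric:
  fixes a b c z :: "'a :: real_normed_field"
  assumes c: "c \<notin> \<int>\<^sub>\<le>\<^sub>0" and z: "norm z < 1"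
  shows "summable (\<lambda>k. norm (pochhammer a k * pochhammer b k / (pochhammer c k * fact k) * z ^ k))"
proof (rule summable_norm_ratio_limit)
  let ?R = "\<lambda>k. (a + of_nat k) / (c + of_nat k) * ((b + of_nat k) / (1 + of_nat k)) * z"
  show "?R \<longlonglongrightarrow> 1 * 1 * z"
    by (intro tendsto_intros shifted_ratio_tendsto_1)
  show "eventually (\<lambda>k. pochhammer a (Suc k) * pochhammer b (Suc k) / (pochhammer c (Suc k) * fact (Suc k)) * z ^ Suc k
      = pochhammer a k * pochhammer b k / (pochhammer c k * fact k) * z ^ k * ?R k) sequentially"
    by (intro always_eventually allI) (simp add: pochhammer_Suc mult_ac)
qed (use z in simp)

text \<open>Absolute summability of all rows and of their norms makes the family summable over
  pairs; the bijection \<open>(n, m)\<close> to \<open>(n + m, n)\<close> then regroups it by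
  diagonals without changing the value.\<close>

lemma sums_diagonal:
  fixes f :: "nat \<Rightarrow> nat \<Rightarrow> 'a :: banach"
  assumes 1: "\<And>n. summable (\<lambda>m. norm (f n m))"
    and 2: "summable (\<lambda>n. \<Sum>m. norm (f n m))"
  shows "(\<lambda>p. \<Sum>n\<le>p. f n (p - n)) sums (\<Sum>n. \<Sum>m. f n m)"
proof -
  let ?F = "\<lambda>(n, m). f n m"
  have s1: "((\<lambda>m. norm (f n m)) has_sum (\<Sum>m. norm (f n m))) UNIV" for n
    by (rule norm_summable_imp_has_sum) (use 1 in \<open>auto simp: summable_sums\<close>)
  have i1: "infsum (\<lambda>m. norm (f n m)) UNIV = (\<Sum>m. norm (f n m))" for n
    using s1 by (rule infsumI)
  have nn: "(\<Sum>m. norm (f n m)) \<ge> 0" for n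
    by (intro suminf_nonneg 1) auto
  have s2: "((\<lambda>n. \<Sum>m. norm (f n m)) has_sum (\<Sum>n. \<Sum>m. norm (f n m))) UNIV"
    by (rule norm_summable_imp_has_sum) (use 2 nn in \<open>auto simp: summable_sums\<close>)
  have abs: "(\<lambda>x. norm (?F x)) summable_on (UNIV \<times> UNIV)"
    using s1 s2 nn by (intro iffD2[OF Infinite_Sum.abs_summable_on_Sigma_iff]) (auto simp: i1 summable_on_def)
  then have sm: "?F summable_on (UNIV \<times> UNIV)"
    by (rule abs_summable_summable)
  then obtain S where S: "(?F has_sum S) (UNIV \<times> UNIV)"
    by (auto simp: summable_on_def)
  have r: "((\<lambda>m. ?F (n, m)) has_sum (\<Sum>m. f n m)) UNIV" for n
    by (auto intro!: norm_summable_imp_has_sum 1 summable_sums summable_norm_cancel[OF 1])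
  have "((\<lambda>n. \<Sum>m. f n m) has_sum S) UNIV"
    by (rule has_sum_SigmaD[OF S]) (use r in auto)
  then have Seq: "S = (\<Sum>n. \<Sum>m. f n m)"
    using has_sum_imp_sums sums_unique by blast
  have "((\<lambda>(p, n). f n (p - n)) has_sum S) (SIGMA p:UNIV. {..p})"
    by (rule iffD1[OF has_sum_reindex_bij_witness S, where i1="\<lambda>(p,n). (n, p - n)" and j1="\<lambda>(n,m). (n + m, n)"]) auto
  then have "((\<lambda>p. \<Sum>n\<le>p. f n (p - n)) has_sum S) UNIV"
    by (rule has_sum_SigmaD) (auto intro!: has_sum_finiteI)
  then show ?thesis
    using Seq has_sum_imp_sums by blast
qed

lemma sums_pochhammer_binomial:
  fixes a z :: complex
  assumes "norm z < 1"
  shows "(\<lambda>j. pochhammer a j / fact j * z ^ j) sums (1 - z) powr (- a)"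
proof -
  have "(\<lambda>n. ((-a) gchoose n) * (-z)^n) sums (1 + (-z)) powr (-a)"
    by (rule gen_binomial_complex) (use assms in simp)
  moreover have "((-a) gchoose n) * (-z)^n = pochhammer a n / fact n * z ^ n" for n
    by (simp add: gbinomial_pochhammer power_minus[of z])
  ultimately show ?thesis by simp
qed

lemma sums_pochhammer_binomial_real:
  fixes a z :: real
  assumes "\<bar>z\<bar> < 1"
  shows "(\<lambda>j. pochhammer a j / fact j * z ^ j) sums (1 - z) powr (- a)"
proof -
  have "(\<lambda>n. ((-a) gchoose n) * (-z)^n) sums (1 + (-z)) powr (-a)"
    by (rule gen_binomial_real) (use assms in simp)
  moreover have "((-a) gchoose n) * (-z)^n = pochhammer a n / fact n * z ^ n" for n
    by (simp add: gbinomial_pochhammer power_minus[of z])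
  ultimately show ?thesis by simp
qed

section \<open>Binomial transforms and Pfaff's transformation\<close>

text \<open>This is Chu-Vandermonde with \<open>(-1)^q (p choose q) = (-p)_q / q!\<close>. It says
  that the binomial transform replaces the upper parameter \<open>b\<close> by \<open>c - b\<close>,
  the form in which Pfaff's transformation uses it.\<close>

lemma binomial_pochhammer_Vandermonde:
  fixes b c :: "'a :: field_char_0"
  assumes "c \<notin> \<int>\<^sub>\<le>\<^sub>0"
  shows "(\<Sum>q\<le>p. (-1) ^ q * of_nat (p choose q) * (pochhammer b q / pochhammer c q))
         = pochhammer (c - b) p / pochhammer c p"
proof -
  have "(-1) ^ q * of_nat (p choose q) * (pochhammer b q / pochhammer c q)
     = pochhammer b q * pochhammer (- of_nat p) q / (of_nat (fact q) * pochhammer c q)" for q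
    by (simp add: binomial_gbinomial gbinomial_pochhammer)
  moreover have "\<forall>i\<in>{0..<p}. c \<noteq> - of_nat i"
    using assms by auto
  ultimately show ?thesis
    using Vandermonde_pochhammer[of p c b] by (simp add: atMost_atLeast0)
qed

lemma choose_pochhammer_split:
  fixes a :: "'a :: field_char_0"
  assumes "q \<le> p"
  shows "pochhammer a q / fact q * (pochhammer (a + of_nat q) (p - q) / fact (p - q))
       = pochhammer a p / fact p * of_nat (p choose q)"
  using assms by (simp add: pochhammer_product[OF assms] binomial_fact)

text \<open>Pfaff's transformation with arbitrary coefficients: it trades a power series for its
  binomial transform. Vandermonde's identity turns it into the classical case.\<close>
lemma Pfaff_transform_small:
  fixes \<alpha> z :: complex and v :: "nat \<Rightarrow> complex"
  assumes sv: "\<And>z. norm z < 1 \<Longrightarrow> summable (\<lambda>q. pochhammer \<alpha> q / fact q * v q * z ^ q)"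
    and z: "norm z < 1 / 2"
  shows "(\<lambda>p. pochhammer \<alpha> p / fact p * (\<Sum>q\<le>p. (-1) ^ q * of_nat (p choose q) * v q) * z ^ p) sums
     ((1 - z) powr (- \<alpha>) * (\<Sum>q. pochhammer \<alpha> q / fact q * v q * (z / (z - 1)) ^ q))"
proof -
  define t where "t = norm z"
  define k where "k q = pochhammer \<alpha> q / fact q * v q" for q
  \<comment> \<open>Each factor \<open>(1 - z) powr -(\<alpha> + q)\<close> is expanded by the
    binomial series. Rows of \<open>f\<close> sum to the right-hand side of the claim, diagonals to
    the terms of the left-hand side.\<close>
  define f where "f q j = k q * (-z) ^ q * (pochhammer (\<alpha> + of_nat q) j / fact j * z ^ j)" for q j
  have t: "0 \<le> t" "t < 1 / 2" using z by (auto simp: t_def)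
  have z1: "z \<noteq> 1" using t by (auto simp: t_def)
  have "(\<lambda>j. norm (k q) * t ^ q * (pochhammer (norm \<alpha> + of_nat q) j / fact j * t ^ j)) sums
        (norm (k q) * t ^ q * (1 - t) powr (- (norm \<alpha> + of_nat q)))" for q
    by (intro sums_mult sums_pochhammer_binomial_real) (use t in auto)
  moreover have "norm (k q) * t ^ q * (1 - t) powr (- (norm \<alpha> + of_nat q))
      = (1 - t) powr (- norm \<alpha>) * (norm (k q) * (t / (1 - t)) ^ q)" for q
    using t by (simp add: powr_diff powr_realpow power_divide)
  ultimately have dom: "(\<lambda>j. norm (k q) * t ^ q * (pochhammer (norm \<alpha> + of_nat q) j / fact j * t ^ j)) sums
       ((1 - t) powr (- norm \<alpha>) * (norm (k q) * (t / (1 - t)) ^ q))" for q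
    by (simp only:)
  have fle: "norm (f q j) \<le> norm (k q) * t ^ q * (pochhammer (norm \<alpha> + of_nat q) j / fact j * t ^ j)" for q j
  proof -
    have "norm (pochhammer (\<alpha> + of_nat q) j) \<le> pochhammer (norm (\<alpha> + of_nat q)) j"
      by (rule norm_pochhammer_le)
    also have "\<dots> \<le> pochhammer (norm \<alpha> + of_nat q) j"
      unfolding pochhammer_prod using norm_triangle_ineq[of \<alpha> "of_nat q"] by (intro prod_mono) auto
    finally show ?thesis
      unfolding f_def norm_mult norm_divide norm_power t_def[symmetric] norm_minus_cancel
      by (intro mult_left_mono mult_right_mono) (auto simp: t_def divide_right_mono)
  qed
  have s1: "summable (\<lambda>j. norm (f q j))" for q
    by (rule summable_comparison_test'[OF sums_summable[OF dom]]) (use fle in auto)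
  have le: "(\<Sum>j. norm (f q j)) \<le> (1 - t) powr (- norm \<alpha>) * (norm (k q) * (t / (1 - t)) ^ q)" for q
    unfolding sums_unique[OF dom] by (intro suminf_le fle s1 sums_summable[OF dom])
  have dom2: "summable (\<lambda>q. (1 - t) powr (- norm \<alpha>) * (norm (k q) * (t / (1 - t)) ^ q))"
  proof (intro summable_mult)
    \<comment> \<open>Here \<open>t < 1/2\<close> enters: \<open>t / (1 - t) < 1\<close>, so there
      is room for a radius \<open>r < 1\<close> at which the series of \<open>k\<close> converges,
      which gives absolute convergence at the smaller point \<open>t / (1 - t)\<close>.\<close>
    obtain r where r: "t / (1 - t) < r" "r < 1"
      using dense[of "t / (1 - t)" 1] t by auto
    have r0: "0 \<le> t / (1 - t)" "\<bar>t / (1 - t)\<bar> = t / (1 - t)" using t by auto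
    have "summable (\<lambda>q. k q * complex_of_real r ^ q)"
      unfolding k_def by (rule sv) (use r r0 in auto)
    then have "summable (\<lambda>q. norm (k q * complex_of_real (t / (1 - t)) ^ q))"
      by (rule powser_insidea) (use r r0 in \<open>simp del: of_real_divide of_real_diff abs_divide\<close>)
    then show "summable (\<lambda>q. norm (k q) * (t / (1 - t)) ^ q)"
      using r0 by (simp add: norm_mult norm_power del: of_real_divide of_real_diff abs_divide)
  qed
  have s2: "summable (\<lambda>q. \<Sum>j. norm (f q j))"
    by (rule summable_comparison_test'[OF dom2]) (use le suminf_nonneg[OF s1] in simp)
  have diag: "(\<Sum>q\<le>p. f q (p - q)) = pochhammer \<alpha> p / fact p * (\<Sum>q\<le>p. (-1) ^ q * of_nat (p choose q) * v q) * z ^ p" for p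
  proof -
    have "f q (p - q) = pochhammer \<alpha> p / fact p * ((-1) ^ q * of_nat (p choose q) * v q) * z ^ p" if "q \<le> p" for q
    proof -
      have "f q (p - q) = (pochhammer \<alpha> q / fact q * (pochhammer (\<alpha> + of_nat q) (p - q) / fact (p - q)))
              * ((-1) ^ q * v q) * (z ^ q * z ^ (p - q))"
        by (simp add: f_def k_def power_minus[of z])
      also have "z ^ q * z ^ (p - q) = z ^ p"
        using that by (simp flip: power_add)
      finally show ?thesis
        unfolding choose_pochhammer_split[OF that] by simp
    qed
    then show ?thesis
      by (simp add: sum_distrib_left sum_distrib_right)
  qed
  have row: "(\<Sum>j. f q j) = (1 - z) powr (- \<alpha>) * (k q * (z / (z - 1)) ^ q)" for q
  proof -
    have "(\<lambda>j. f q j) sums (k q * (-z) ^ q * (1 - z) powr (- (\<alpha> + of_nat q)))"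
      unfolding f_def by (intro sums_mult sums_pochhammer_binomial) (use t t_def in auto)
    moreover have "(-z) ^ q * (1 - z) powr (- (\<alpha> + of_nat q)) = (1 - z) powr (- \<alpha>) * (z / (z - 1)) ^ q"
    proof -
      have "(z / (z - 1)) ^ q = ((-z) / (1 - z)) ^ q"
        using z1 by (intro arg_cong[where f="\<lambda>x. x ^ q"]) (simp add: field_simps)
      also have "\<dots> = (-z) ^ q / (1 - z) ^ q"
        by (rule power_divide)
      finally show ?thesis
        using z1 by (simp add: powr_diff powr_nat)
    qed
    ultimately show ?thesis
      by (simp add: sums_iff mult_ac)
  qed
  have "summable (\<lambda>q. k q * (z / (z - 1)) ^ q)"
    unfolding k_def
  proof (rule sv)
    have "1 - t \<le> norm (z - 1)"
      using norm_triangle_ineq2[of 1 z] by (simp add: t_def norm_minus_commute)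
    then have "t < norm (z - 1)" using t by linarith
    then show "norm (z / (z - 1)) < 1"
      using z1 by (simp add: norm_divide t_def field_simps)
  qed
  from suminf_mult[OF this] show ?thesis
    using sums_diagonal[OF s1 s2] unfolding diag row k_def by (simp only:)
qed

text \<open>Analytic continuation of the small-disc case: both sides are holomorphic on the convex
  set \<open>|z| < 1\<close>, \<open>Re z < 1/2\<close>, which contains the disc of radius 1/2. In
  particular all points \<open>z = -x\<close> with \<open>0 \<le> x < 1\<close> are reached.\<close>

lemma Pfaff_transform:
  fixes \<alpha> z :: complex and v :: "nat \<Rightarrow> complex"
  defines "u \<equiv> \<lambda>p. \<Sum>q\<le>p. (-1) ^ q * of_nat (p choose q) * v q"
  assumes sv: "\<And>z. norm z < 1 \<Longrightarrow> summable (\<lambda>q. pochhammer \<alpha> q / fact q * v q * z ^ q)"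
    and su: "\<And>z. norm z < 1 \<Longrightarrow> summable (\<lambda>p. pochhammer \<alpha> p / fact p * u p * z ^ p)"
    and z: "norm z < 1" "Re z < 1 / 2"
  shows "(\<Sum>p. pochhammer \<alpha> p / fact p * u p * z ^ p) =
     (1 - z) powr (- \<alpha>) * (\<Sum>q. pochhammer \<alpha> q / fact q * v q * (z / (z - 1)) ^ q)"
proof -
  define S where "S = ball (0::complex) 1 \<inter> {z. Re z < 1 / 2}"
  define U where "U z = (\<Sum>p. pochhammer \<alpha> p / fact p * u p * z ^ p)" for z
  define V where "V w = (\<Sum>q. pochhammer \<alpha> q / fact q * v q * w ^ q)" for w
  have U: "U holomorphic_on ball 0 1"
    unfolding U_def by (rule power_series_holomorphic[where a="\<lambda>n. pochhammer \<alpha> n / fact n * u n"]) (use su in \<open>auto simp: summable_sums\<close>)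
  have V: "V holomorphic_on ball 0 1"
    unfolding V_def by (rule power_series_holomorphic[where a="\<lambda>n. pochhammer \<alpha> n / fact n * v n"]) (use sv in \<open>auto simp: summable_sums\<close>)
  have S1: "z \<noteq> 1" if "z \<in> S" for z using that by (auto simp: S_def)
  have ball: "z / (z - 1) \<in> ball 0 1" if "z \<in> S" for z
  proof -
    \<comment> \<open>The difference of the two squares is \<open>1 - 2 Re z\<close>, so the
      half-plane condition is exactly what keeps \<open>z / (z - 1)\<close> inside the unit
      disc.\<close>
    have "(norm z)\<^sup>2 < (norm (z - 1))\<^sup>2"
      using that unfolding S_def cmod_power2 by (simp add: power2_eq_square algebra_simps)
    then have "norm z < norm (z - 1)"
      using power_less_imp_less_base by fastforce
    then show ?thesis
      using S1[OF that] by (simp add: norm_divide field_simps)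
  qed
  have "(V \<circ> (\<lambda>z. z / (z - 1))) holomorphic_on S"
    by (rule holomorphic_on_compose_gen[OF _ V]) (use ball S1 in \<open>auto intro!: holomorphic_intros\<close>)
  then have hV: "(\<lambda>z. (1 - z) powr (- \<alpha>) * V (z / (z - 1))) holomorphic_on S"
    unfolding o_def
    by (intro holomorphic_intros) (auto simp: S_def complex_nonpos_Reals_iff)
  have hU: "U holomorphic_on S"
    using U by (rule holomorphic_on_subset) (auto simp: S_def)
  have S: "open S" "convex S"
    unfolding S_def by (intro open_Int convex_Int open_ball convex_ball open_halfspace_Re_lt convex_halfspace_Re_lt)+
  have eq: "U z = (1 - z) powr (- \<alpha>) * V (z / (z - 1))" if "z \<in> ball 0 (1/2)" for z
    using Pfaff_transform_small[OF sv, of z] that unfolding U_def V_def u_def by (simp add: sums_iff)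
  have sub: "ball 0 (1/2) \<subseteq> S"
  proof
    fix w :: complex assume "w \<in> ball 0 (1/2)"
    then show "w \<in> S"
      using complex_Re_le_cmod[of w] by (simp add: S_def)
  qed
  have "U z = (1 - z) powr (- \<alpha>) * V (z / (z - 1))"
    by (rule analytic_continuation_open[OF _ S(1) _ convex_connected[OF S(2)] sub hU hV eq])
       (use z in \<open>auto simp: S_def\<close>)
  then show ?thesis by (simp add: U_def V_def)
qed

section \<open>Summation by parts against multipliers of bounded variation\<close>

text \<open>Abel summation leaves two boundary terms and one sum over the variation of
  \<open>g\<close>; each is at most \<open>\<epsilon> * V\<close>, whence the factor 3.\<close>

lemma norm_sum_by_parts_le:
  fixes R g :: "nat \<Rightarrow> 'a :: real_normed_algebra"
  assumes "M \<le> N" and R: "\<And>n. M \<le> n \<Longrightarrow> norm (R n) \<le> \<epsilon>"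
    and g: "\<And>n. norm (g n) \<le> V" and var: "\<And>N. (\<Sum>n<N. norm (g (Suc n) - g n)) \<le> V"
  shows "norm (\<Sum>n\<in>{M..<N}. (R n - R (Suc n)) * g n) \<le> 3 * \<epsilon> * V"
proof -
  have eps: "\<epsilon> \<ge> 0" using R[of M] by (meson norm_ge_zero order.refl order_trans)
  have V: "V \<ge> 0" using g[of 0] by (meson norm_ge_zero order_trans)
  have eq: "(\<Sum>n\<in>{M..<N}. (R n - R (Suc n)) * g n)
      = R M * g M - R N * g N + (\<Sum>n\<in>{M..<N}. R (Suc n) * (g (Suc n) - g n))"
    using assms(1) by (induction rule: dec_induct) (auto simp: algebra_simps)
  have "norm (R n * g n) \<le> \<epsilon> * V" if "M \<le> n" for n
    by (rule order_trans[OF norm_mult_ineq]) (use R[OF that] g eps in \<open>auto intro!: mult_mono\<close>)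
  then have *: "norm (R M * g M) \<le> \<epsilon> * V" "norm (R N * g N) \<le> \<epsilon> * V"
    using assms(1) by auto
  have "norm (\<Sum>n\<in>{M..<N}. R (Suc n) * (g (Suc n) - g n)) \<le> (\<Sum>n\<in>{M..<N}. \<epsilon> * norm (g (Suc n) - g n))"
    by (rule sum_norm_le, rule order_trans[OF norm_mult_ineq])
       (use R in \<open>auto intro!: mult_right_mono\<close>)
  also have "\<dots> \<le> (\<Sum>n<N. \<epsilon> * norm (g (Suc n) - g n))"
    using eps by (intro sum_mono2) auto
  also have "\<dots> \<le> \<epsilon> * V"
    using var[of N] eps by (simp add: mult_left_mono flip: sum_distrib_left)
  finally have "norm (\<Sum>n\<in>{M..<N}. R (Suc n) * (g (Suc n) - g n)) \<le> \<epsilon> * V" .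
  then show ?thesis
    unfolding eq using *
      norm_triangle_ineq[of "R M * g M - R N * g N" "\<Sum>n\<in>{M..<N}. R (Suc n) * (g (Suc n) - g n)"]
      norm_triangle_ineq4[of "R M * g M" "R N * g N"]
    by linarith
qed

text \<open>With \<open>R\<close> the tails of the series, \<open>e n = R n - R (Suc n)\<close>, so
  merely conditional convergence of \<open>e\<close> survives multiplication by sequences whose size
  and total variation are bounded. In the second claim \<open>E\<close> depends on \<open>e\<close>
  alone, which later provides a majorant uniform in the truncation.\<close>

lemma
  fixes e :: "nat \<Rightarrow> 'a :: {real_normed_algebra, banach}"
  assumes e: "summable e"
  shows uniform_limit_bounded_variation:
      "\<And>X V g. (\<And>n x. x \<in> X \<Longrightarrow> norm (g n x) \<le> V) \<Longrightarrow>
        (\<And>N x. x \<in> X \<Longrightarrow> (\<Sum>n<N. norm (g (Suc n) x - g n x)) \<le> V) \<Longrightarrow>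
        uniform_limit X (\<lambda>N x. \<Sum>n<N. e n * g n x) (\<lambda>x. \<Sum>n. e n * g n x) sequentially"
    and partial_sums_bounded_variation:
      "\<exists>E. \<forall>V g. (\<forall>n. norm (g n) \<le> V) \<longrightarrow> (\<forall>N. (\<Sum>n<N. norm (g (Suc n) - g n)) \<le> V) \<longrightarrow>
        (\<forall>N. norm (\<Sum>n<N. e n * g n) \<le> E * V)"
proof -
  define R where "R n = (\<Sum>k. e (k + n))" for n
  have eR: "e n = R n - R (Suc n)" for n
    using suminf_split_head[of "\<lambda>k. e (k + n)"] e by (simp add: R_def summable_iff_shift)
  have R0: "R \<longlonglongrightarrow> 0"
    unfolding R_def using suminf_exist_split2[OF e] by simp
  {
    fix X V and g :: "nat \<Rightarrow> 'b \<Rightarrow> 'a"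
    assume g: "\<And>n x. x \<in> X \<Longrightarrow> norm (g n x) \<le> V"
      and var: "\<And>N x. x \<in> X \<Longrightarrow> (\<Sum>n<N. norm (g (Suc n) x - g n x)) \<le> V"
    have "uniformly_Cauchy_on X (\<lambda>N x. \<Sum>n<N. e n * g n x)"
    proof (rule uniformly_Cauchy_onI')
      fix \<epsilon> :: real assume eps: "\<epsilon> > 0"
      \<comment> \<open>The tail bound is chosen so that
        \<open>3 * \<delta> * V < \<epsilon>\<close>. Using \<open>\<bar>V\<bar> + 1\<close> keeps
        the denominator positive, since the sign of \<open>V\<close> is unknown when
        \<open>X\<close> is empty.\<close>
      define \<delta> where "\<delta> = \<epsilon> / (3 * (\<bar>V\<bar> + 1))"
      have "\<delta> > 0" using eps by (auto simp: \<delta>_def)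
      then obtain M where M: "\<And>n. n \<ge> M \<Longrightarrow> norm (R n) \<le> \<delta>"
        using R0 unfolding LIMSEQ_iff by (metis diff_zero less_imp_le)
      show "\<exists>M. \<forall>x\<in>X. \<forall>m\<ge>M. \<forall>n>m. dist (\<Sum>n<m. e n * g n x) (\<Sum>n<n. e n * g n x) < \<epsilon>"
      proof (intro exI[of _ M] ballI allI impI)
        fix x m n assume x: "x \<in> X" and mn: "M \<le> m" "m < n"
        have "dist (\<Sum>n<m. e n * g n x) (\<Sum>n<n. e n * g n x) = norm (\<Sum>k\<in>{m..<n}. (R k - R (Suc k)) * g k x)"
          using mn sum_diff_nat_ivl[of 0 m n "\<lambda>k. e k * g k x"]
          unfolding dist_norm lessThan_atLeast0 eR[symmetric] by (subst norm_minus_commute) simp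
        also have "\<dots> \<le> 3 * \<delta> * V"
          by (rule norm_sum_by_parts_le) (use mn M g[OF x] var[OF x] in auto)
        also have "\<dots> \<le> 3 * \<delta> * \<bar>V\<bar>"
          using \<open>\<delta> > 0\<close> by (intro mult_left_mono) auto
        also have "\<dots> < 3 * \<delta> * (\<bar>V\<bar> + 1)"
          using \<open>\<delta> > 0\<close> by (intro mult_strict_left_mono) auto
        also have "\<dots> = \<epsilon>"
          by (simp add: \<delta>_def divide_simps)
        finally show "dist (\<Sum>n<m. e n * g n x) (\<Sum>n<n. e n * g n x) < \<epsilon>" .
      qed
    qed
    then have "uniformly_convergent_on X (\<lambda>N x. \<Sum>n<N. e n * g n x)"
      by (rule Cauchy_uniformly_convergent)
    then obtain l where l: "uniform_limit X (\<lambda>N x. \<Sum>n<N. e n * g n x) l sequentially"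
      by (auto simp: uniformly_convergent_on_def)
    have "l x = (\<Sum>n. e n * g n x)" if "x \<in> X" for x
      using tendsto_uniform_limitI[OF l that] by (simp add: sums_def sums_unique)
    then show "uniform_limit X (\<lambda>N x. \<Sum>n<N. e n * g n x) (\<lambda>x. \<Sum>n. e n * g n x) sequentially"
      using l by (subst uniform_limit_cong'[where g="\<lambda>N x. \<Sum>n<N. e n * g n x" and i=l]) auto
  }
  from R0 have "Bseq R"
    by (intro convergent_imp_Bseq convergentI)
  then obtain E where E: "\<And>n. norm (R n) \<le> E"
    by (auto simp: Bseq_def)
  show "\<exists>E. \<forall>V g. (\<forall>n. norm (g n) \<le> V) \<longrightarrow> (\<forall>N. (\<Sum>n<N. norm (g (Suc n) - g n)) \<le> V) \<longrightarrow>
        (\<forall>N. norm (\<Sum>n<N. e n * g n) \<le> E * V)"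
  proof (intro exI allI impI)
    fix V N and g :: "nat \<Rightarrow> 'a"
    assume "\<forall>n. norm (g n) \<le> V" "\<forall>N. (\<Sum>n<N. norm (g (Suc n) - g n)) \<le> V"
    then have "norm (\<Sum>n\<in>{0..<N}. (R n - R (Suc n)) * g n) \<le> 3 * E * V"
      by (intro norm_sum_by_parts_le E) auto
    then show "norm (\<Sum>n<N. e n * g n) \<le> 3 * E * V"
      unfolding lessThan_atLeast0 eR[symmetric] .
  qed
qed

section \<open>Hypergeometric sums at one half\<close>

text \<open>Division by \<open>\<Gamma>(c)\<close> keeps the contiguous relations valid when \<^term>\<open>c - 1\<close> is a
  non-positive integer.\<close>
definition reg_hyp_half :: "complex \<Rightarrow> complex \<Rightarrow> complex \<Rightarrow> complex" where
  "reg_hyp_half a b c = (\<Sum>k. pochhammer a k * pochhammer b k / fact k * (1/2) ^ k * rGamma (c + of_nat k))"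

lemma reg_hyp_half_sums:
  "(\<lambda>k. pochhammer a k * pochhammer b k / fact k * (1/2) ^ k * rGamma (c + of_nat k)) sums reg_hyp_half a b c"
proof -
  let ?R = "\<lambda>k. (a + of_nat k) / (c + of_nat k) * ((b + of_nat k) / (1 + of_nat k)) * (1/2) :: complex"
  have inf: "filterlim (\<lambda>k. c + of_nat k :: complex) at_infinity sequentially"
    by (intro tendsto_add_filterlim_at_infinity[OF tendsto_const] tendsto_of_nat)
  then have ne: "eventually (\<lambda>k. c + of_nat k \<noteq> 0) sequentially"
    by (simp add: filterlim_at_infinity_imp_eventually_ne)
  have "summable (\<lambda>k. norm (pochhammer a k * pochhammer b k / fact k * (1/2) ^ k * rGamma (c + of_nat k)))"
  proof (rule summable_norm_ratio_limit)
    show "?R \<longlonglongrightarrow> 1 * 1 * (1/2)"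
      by (intro tendsto_intros shifted_ratio_tendsto_1)
    show "eventually (\<lambda>k. pochhammer a (Suc k) * pochhammer b (Suc k) / fact (Suc k) * (1/2) ^ Suc k * rGamma (c + of_nat (Suc k))
      = pochhammer a k * pochhammer b k / fact k * (1/2) ^ k * rGamma (c + of_nat k) * ?R k) sequentially"
      using ne
    proof eventually_elim
      case (elim k)
      have "rGamma (c + of_nat (Suc k)) = rGamma (c + of_nat k) / (c + of_nat k)"
        using rGamma_plus1[of "c + of_nat k"] elim by (simp add: field_simps)
      then show ?case
        by (simp add: pochhammer_Suc mult_ac)
    qed
  qed (simp add: norm_divide)
  then show ?thesis
    unfolding reg_hyp_half_def by (rule summable_sums[OF summable_norm_cancel])
qed

lemma reg_hyp_half_eq_hypergeometric:
  assumes "c \<notin> \<int>\<^sub>\<le>\<^sub>0"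
  shows "reg_hyp_half a b c = rGamma c * (\<Sum>k. pochhammer a k * pochhammer b k / (pochhammer c k * fact k) * (1/2) ^ k)"
proof -
  have "summable (\<lambda>k. pochhammer a k * pochhammer b k / (pochhammer c k * fact k) * (1/2) ^ k)"
    by (rule summable_norm_cancel[OF summable_norm_hypergeometric[OF assms]]) (simp add: norm_divide)
  from suminf_mult[OF this, of "rGamma c"]
  have "rGamma c * (\<Sum>k. pochhammer a k * pochhammer b k / (pochhammer c k * fact k) * (1/2) ^ k)
     = (\<Sum>k. rGamma c * (pochhammer a k * pochhammer b k / (pochhammer c k * fact k) * (1/2) ^ k))"
    by (simp only:)
  moreover have "rGamma c * (pochhammer a k * pochhammer b k / (pochhammer c k * fact k) * (1/2) ^ k)
     = pochhammer a k * pochhammer b k / fact k * (1/2) ^ k * rGamma (c + of_nat k)" for k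
    using pochhammer_nonzero[OF assms] by (simp add: pochhammer_rGamma[of c k] field_simps)
  ultimately show ?thesis
    unfolding reg_hyp_half_def by simp
qed

section \<open>Contiguous relations at argument 1/2\<close>

text \<open>The identity holds term by term: \<open>a (a+1)_k = (a)_k (a + k)\<close>, where
  \<open>a + k = (c - 1 + k) - (c - 1 - a)\<close> and the factor \<open>c - 1 + k\<close> lowers
  the argument of \<open>rGamma\<close> by one.\<close>

lemma reg_hyp_half_raise_upper:
  "a * reg_hyp_half (a + 1) b c = reg_hyp_half a b (c - 1) - (c - 1 - a) * reg_hyp_half a b c"
proof -
  let ?t = "\<lambda>a c k. pochhammer a k * pochhammer b k / fact k * (1/2) ^ k * rGamma (c + of_nat k)"
  have "a * ?t (a + 1) c k = ?t a (c - 1) k - (c - 1 - a) * ?t a c k" for k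
  proof -
    have 1: "a * pochhammer (a + 1) k = pochhammer a k * (a + of_nat k)"
      using pochhammer_rec[of a k] pochhammer_Suc[of a k] by simp
    have 2: "rGamma (c - 1 + of_nat k) = (c - 1 + of_nat k) * rGamma (c + of_nat k)"
      using rGamma_plus1[of "c - 1 + of_nat k"] by (simp add: add.commute add_diff_eq)
    have "a * ?t (a + 1) c k = (a * pochhammer (a + 1) k) * (pochhammer b k / fact k * (1/2) ^ k * rGamma (c + of_nat k))"
      by (simp add: mult_ac)
    then show ?thesis
      unfolding 1 2 by (simp add: field_simps)
  qed
  moreover have "(\<lambda>k. a * ?t (a + 1) c k) sums (a * reg_hyp_half (a + 1) b c)"
    by (intro sums_mult reg_hyp_half_sums)
  moreover have "(\<lambda>k. ?t a (c - 1) k - (c - 1 - a) * ?t a c k) sums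
      (reg_hyp_half a b (c - 1) - (c - 1 - a) * reg_hyp_half a b c)"
    by (intro sums_diff sums_mult reg_hyp_half_sums)
  ultimately show ?thesis
    by (simp only: sums_unique2)
qed

text \<open>Start from \<open>(b)_(k+1) = (b+1)_(k+1) - (k+1) (b+1)_k\<close>. The factor
  \<open>k + 1\<close> cancels against the factorial, so the second part is a shifted series with a
  factor 1/2; there \<open>a + k = (c + k) - (c - a)\<close> splits it into the series at
  \<open>c\<close> and at \<open>c + 1\<close>. The identity thus needs an index shift and does not
  hold termwise.\<close>

lemma reg_hyp_half_lower_upper:
  "reg_hyp_half a b c = reg_hyp_half a (b + 1) c / 2 + (c - a) / 2 * reg_hyp_half a (b + 1) (c + 1)"
proof -
  let ?t = "\<lambda>b c k. pochhammer a k * pochhammer b k / fact k * (1/2) ^ k * rGamma (c + of_nat k)"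
  have step: "?t b c (Suc k) = ?t (b + 1) c (Suc k) - 1/2 * ?t (b + 1) c k + (c - a) / 2 * ?t (b + 1) (c + 1) k" for k
  proof -
    define B where "B = pochhammer (b + 1) k"
    define A where "A = pochhammer a k"
    define G where "G = rGamma (c + 1 + of_nat k)"
    define F where "F = (fact k :: complex)"
    define H where "H = (1/2 :: complex) ^ k"
    define S where "S = (1 + of_nat k :: complex)"
    have nz: "F \<noteq> 0" "S \<noteq> 0" by (auto simp: F_def S_def add_eq_0_iff simp flip: of_nat_Suc)
    have 1: "pochhammer b (Suc k) = b * B" "pochhammer (b + 1) (Suc k) = B * (b + S)"
      unfolding B_def S_def using pochhammer_rec[of b k] pochhammer_Suc[of "b + 1" k] by (simp_all only: add.assoc)
    have 2: "rGamma (c + of_nat k) = (c + S - 1) * G"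
      using rGamma_plus1[of "c + of_nat k"] by (simp add: add_ac G_def S_def)
    have 3: "rGamma (c + of_nat (Suc k)) = G" by (simp add: add_ac G_def)
    have 4: "pochhammer a (Suc k) = A * (a + S - 1)" "fact (Suc k) = S * F" "(1/2 :: complex) ^ Suc k = H / 2"
      by (simp_all add: A_def pochhammer_Suc S_def F_def H_def)
    show ?thesis
      unfolding 1 2 3 4 A_def[symmetric] B_def[symmetric] F_def[symmetric] H_def[symmetric] G_def[symmetric]
      using nz by (simp add: field_simps)
  qed
  have "(\<lambda>k. ?t b c (Suc k)) sums (reg_hyp_half a b c - ?t b c 0)"
    by (subst sums_Suc_iff) (use reg_hyp_half_sums in auto)
  moreover have "(\<lambda>k. ?t (b + 1) c (Suc k) - 1/2 * ?t (b + 1) c k + (c - a) / 2 * ?t (b + 1) (c + 1) k) sums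
      ((reg_hyp_half a (b + 1) c - ?t (b + 1) c 0) - 1/2 * reg_hyp_half a (b + 1) c
        + (c - a) / 2 * reg_hyp_half a (b + 1) (c + 1))"
    by (intro sums_add sums_diff sums_mult reg_hyp_half_sums, subst sums_Suc_iff) (use reg_hyp_half_sums in auto)
  ultimately have "reg_hyp_half a b c - ?t b c 0 = (reg_hyp_half a (b + 1) c - ?t (b + 1) c 0) - 1/2 * reg_hyp_half a (b + 1) c
        + (c - a) / 2 * reg_hyp_half a (b + 1) (c + 1)"
    unfolding step by (rule sums_unique2)
  then show ?thesis
    by simp
qed

section \<open>Bailey's summation for upper parameters a and 1 - a\<close>

text \<open>Creative telescoping: the terms of the two sides differ by
  \<open>G (Suc k) - G k\<close>, with \<open>G 0 = 0\<close> and \<open>G\<close> tending to 0, so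
  the sums agree.\<close>

lemma reg_hyp_half_Bailey_rec:
  "reg_hyp_half a (1 - a) c = (c + 1 - a) * (c + a) * reg_hyp_half a (1 - a) (c + 2)"
proof -
  define t where "t k = pochhammer a k * pochhammer (1 - a) k / fact k * (1/2) ^ k" for k
  \<comment> \<open>Gosper certificate of the recurrence\<close>
  define G where "G k = - 2 * of_nat k * (t k * rGamma (c + 1 + of_nat k))" for k
  have T: "(\<lambda>k. t k * rGamma (c + of_nat k)) sums reg_hyp_half a (1 - a) c" for c
    unfolding t_def by (rule reg_hyp_half_sums)
  have rG: "rGamma (c + of_nat k) = (c + of_nat k) * rGamma (c + 1 + of_nat k)" for c k
    using rGamma_plus1[of "c + of_nat k"] by (simp add: add_ac)
  have step: "t k * rGamma (c + of_nat k) - (c + 1 - a) * (c + a) * (t k * rGamma (c + 2 + of_nat k)) = G (Suc k) - G k" for k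
  proof -
    define R where "R = rGamma (c + 2 + of_nat k)"
    have 1: "rGamma (c + 1 + of_nat k) = (c + 1 + of_nat k) * R"
      using rG[of "c + 1" k] by (simp add: R_def add_ac)
    have 2: "rGamma (c + of_nat k) = (c + of_nat k) * ((c + 1 + of_nat k) * R)"
      using rG[of c k] 1 by simp
    have 3: "of_nat (Suc k) * t (Suc k) = t k * (a + of_nat k) * (1 - a + of_nat k) / 2"
      by (simp add: t_def pochhammer_Suc field_simps del: of_nat_Suc)
    have 4: "rGamma (c + 1 + of_nat (Suc k)) = R"
      by (simp add: R_def add_ac)
    have "G (Suc k) = - 2 * (t k * (a + of_nat k) * (1 - a + of_nat k) / 2) * R"
      unfolding G_def 4 3[symmetric] by (simp add: mult_ac)
    moreover have "G k = - 2 * of_nat k * (t k * ((c + 1 + of_nat k) * R))"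
      unfolding G_def 1 ..
    ultimately show ?thesis
      unfolding 2 R_def[symmetric] by (simp only:) (simp add: field_simps)
  qed
  \<comment> \<open>Writing \<open>k = (c + k) - c\<close> exhibits \<open>G k\<close> as a
    combination of terms of two convergent series, which tend to 0.\<close>
  have "G k = - 2 * (t k * rGamma (c + of_nat k) - c * (t k * rGamma (c + 1 + of_nat k)))" for k
    unfolding G_def rG[of c k] by (simp add: algebra_simps)
  moreover have "(\<lambda>k. - 2 * (t k * rGamma (c + of_nat k) - c * (t k * rGamma (c + 1 + of_nat k)))) \<longlonglongrightarrow> - 2 * (0 - c * 0)"
    by (intro tendsto_intros summable_LIMSEQ_zero sums_summable[OF T])
  ultimately have "G \<longlonglongrightarrow> 0"
    by (subst tendsto_cong[OF always_eventually]) (rule allI, assumption, simp)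
  then have "(\<lambda>k. G (Suc k) - G k) sums (0 - G 0)"
    by (rule telescope_sums)
  moreover have "(\<lambda>k. t k * rGamma (c + of_nat k) - (c + 1 - a) * (c + a) * (t k * rGamma (c + 2 + of_nat k))) sums
      (reg_hyp_half a (1 - a) c - (c + 1 - a) * (c + a) * reg_hyp_half a (1 - a) (c + 2))"
    by (intro sums_diff sums_mult T)
  ultimately have "0 - G 0 = reg_hyp_half a (1 - a) c - (c + 1 - a) * (c + a) * reg_hyp_half a (1 - a) (c + 2)"
    unfolding step by (rule sums_unique2)
  then show ?thesis
    by (simp add: G_def)
qed

text \<open>Legendre's duplication formula in entire form. At a pole of either factor on the right,
  \<open>2 * z\<close> is a non-positive integer as well and both sides vanish.\<close>

lemma rGamma_duplication:
  fixes z :: complex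
  shows "rGamma (2 * z) = 2 powr (1 - 2 * z) * of_real (sqrt pi) * (rGamma z * rGamma (z + 1/2))"
proof (cases "z \<in> \<int>\<^sub>\<le>\<^sub>0 \<or> z + 1/2 \<in> \<int>\<^sub>\<le>\<^sub>0")
  case False
  then have nz: "Gamma z \<noteq> 0" "Gamma (z + 1/2) \<noteq> 0"
    by (auto simp: Gamma_eq_zero_iff)
  have p: "exp ((1 - 2 * z) * of_real (ln 2)) = 2 powr (1 - 2 * z)"
    using Ln_of_real[of 2] by (simp add: powr_def mult.commute)
  have "Gamma z * Gamma (z + 1/2) = 2 powr (1 - 2 * z) * of_real (sqrt pi) * Gamma (2 * z)"
    using Gamma_legendre_duplication[of z] False p by simp
  moreover from this have "Gamma (2 * z) \<noteq> 0" using nz by auto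
  ultimately show ?thesis
    using nz by (simp add: rGamma_inverse_Gamma field_simps)
next
  case True
  have "2 * z \<in> \<int>\<^sub>\<le>\<^sub>0"
  proof -
    from True consider n where "z = - of_nat n" | n where "z + 1/2 = - of_nat n"
      by (auto elim!: nonpos_Ints_cases')
    then show ?thesis
    proof cases
      case 1
      then have "2 * z = - of_nat (2 * n)" by simp
      then show ?thesis by (metis minus_of_nat_in_nonpos_Ints)
    next
      case 2
      then have "z = - of_nat n - 1/2" by (simp add: eq_diff_eq)
      then have "2 * z = - of_nat (2 * n + 1)" by simp
      then show ?thesis by (metis minus_of_nat_in_nonpos_Ints)
    qed
  qed
  then have "rGamma (2 * z) = 0" by (simp add: rGamma_eq_zero_iff)
  moreover have "rGamma z * rGamma (z + 1/2) = 0" using True by (auto simp: rGamma_eq_zero_iff)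
  ultimately show ?thesis by simp
qed

lemma pochhammer_norm_nonneg: "0 \<le> pochhammer (norm (a :: 'a :: real_normed_field)) k"
  using norm_ge_zero norm_pochhammer_le by (rule order_trans)

lemma norm_pochhammer_ge_Re:
  assumes "Re z \<ge> 0"
  shows "pochhammer (Re z) k \<le> norm (pochhammer z k)"
  unfolding pochhammer_prod prod_norm[symmetric]
  using assms complex_Re_le_cmod[of "z + of_nat _"] by (intro prod_mono) auto

text \<open>Only the term \<open>k = 0\<close> survives as the lower parameter grows. Tannery's
  theorem applies because \<open>Re c > 0\<close> gives the lower bound \<open>(Re c)_k\<close> for
  the norm of \<open>(c + N)_k\<close>, uniformly in \<open>N\<close>.\<close>

lemma hypergeometric_tendsto_1:
  fixes a b c z :: complex
  assumes c: "Re c > 0" and z: "norm z < 1"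
  shows "(\<lambda>N. \<Sum>k. pochhammer a k * pochhammer b k / (pochhammer (c + of_nat N) k * fact k) * z ^ k) \<longlonglongrightarrow> 1"
proof -
  let ?f = "\<lambda>k N. pochhammer a k * pochhammer b k / (pochhammer (c + of_nat N) k * fact k) * z ^ k"
  let ?M = "\<lambda>k. pochhammer (norm a) k * pochhammer (norm b) k / (pochhammer (Re c) k * fact k) * norm z ^ k"
  have "(\<lambda>N. \<Sum>k. ?f k N) \<longlonglongrightarrow> (\<Sum>k. if k = 0 then 1 else 0)"
  proof (rule conjunct2[OF conjunct2[OF tannerys_theorem[where M="?M"]]])
    fix k :: nat
    show "(\<lambda>N. ?f k N) \<longlonglongrightarrow> (if k = 0 then 1 else 0)"
    proof (cases k)
      case (Suc j)
      have "(\<lambda>N. inverse (c + of_nat N + of_nat i :: complex)) \<longlonglongrightarrow> 0" for i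
        using tendsto_inverse_0
          tendsto_add_filterlim_at_infinity[OF tendsto_const[of "c + of_nat i"] tendsto_of_nat]
        by (rule filterlim_compose[THEN filterlim_cong[THEN iffD1, rotated -1]]) (auto simp: add_ac)
      then have "(\<lambda>N. \<Prod>i\<in>{0..<k}. inverse (c + of_nat N + of_nat i)) \<longlonglongrightarrow> (\<Prod>i\<in>{0..<k}. 0 :: complex)"
        by (intro tendsto_prod)
      moreover have "(\<Prod>i\<in>{0..<k}. inverse (c + of_nat N + of_nat i)) = inverse (pochhammer (c + of_nat N) k)" for N
        unfolding pochhammer_prod using prod_inversef[of "\<lambda>i. c + of_nat N + of_nat i" "{0..<k}"] by (simp add: o_def)
      ultimately have "(\<lambda>N. inverse (pochhammer (c + of_nat N) k)) \<longlonglongrightarrow> 0"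
        by (simp add: Suc)
      then have "(\<lambda>N. pochhammer a k * pochhammer b k * inverse (pochhammer (c + of_nat N) k) / fact k * z ^ k)
          \<longlonglongrightarrow> pochhammer a k * pochhammer b k * 0 / fact k * z ^ k"
        by (intro tendsto_intros) auto
      then show ?thesis
        by (simp add: Suc field_simps)
    qed simp
  next
    have "norm (?f k N) \<le> ?M k" for k N
    proof -
      have "pochhammer (Re c) k \<le> pochhammer (Re (c + of_nat N)) k"
        unfolding pochhammer_prod using c by (intro prod_mono) auto
      also have "\<dots> \<le> norm (pochhammer (c + of_nat N) k)"
        by (rule norm_pochhammer_ge_Re) (use c in auto)
      finally have *: "pochhammer (Re c) k \<le> norm (pochhammer (c + of_nat N) k)" .
      have "0 < pochhammer (Re c) k" using c by (rule pochhammer_pos)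
      with * show ?thesis
        unfolding norm_mult norm_divide norm_power
        by (intro mult_right_mono frac_le mult_mono norm_pochhammer_le mult_pos_pos mult_nonneg_nonneg)
           (auto simp: pochhammer_norm_nonneg)
    qed
    then show "\<forall>\<^sub>F (k, N) in sequentially \<times>\<^sub>F sequentially. norm (?f k N) \<le> ?M k"
      by (intro always_eventually) auto
    have "Re c \<notin> \<int>\<^sub>\<le>\<^sub>0" using c by (auto elim!: nonpos_Ints_cases)
    from summable_norm_cancel[OF summable_norm_hypergeometric[OF this, of "norm z" "norm a" "norm b"]]
    show "summable ?M" using z by simp
  qed simp
  then show ?thesis
    using suminf_finite[of "{0}" "\<lambda>k. if k = 0 then 1 else 0 :: complex"] by simp
qed

lemma reg_hyp_half_Bailey_rec_iter:
  "reg_hyp_half a (1 - a) c = 4 ^ N * pochhammer ((c + 1 - a) / 2) N * pochhammer ((c + a) / 2) N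
     * reg_hyp_half a (1 - a) (c + of_nat (2 * N))"
proof (induction N)
  case (Suc N)
  have "reg_hyp_half a (1 - a) (c + of_nat (2 * N)) = (c + of_nat (2 * N) + 1 - a) * (c + of_nat (2 * N) + a)
     * reg_hyp_half a (1 - a) (c + of_nat (2 * Suc N))"
    using reg_hyp_half_Bailey_rec[of a "c + of_nat (2 * N)"] by (simp add: add_ac)
  note rec = this
  show ?case
    by (subst Suc.IH, subst rec, simp only: pochhammer_Suc power_Suc) (simp add: field_simps)
qed simp

text \<open>For \<open>Re c > 0\<close> the recurrence is iterated and the limit taken: the
  Pochhammer products become reciprocal Gamma values, while the remaining series tends to 1. The
  recurrence then transports the formula to every \<open>c\<close>.\<close>

lemma reg_hyp_half_Bailey:
  "reg_hyp_half a (1 - a) c = 2 powr (1 - c) * of_real (sqrt pi) * rGamma ((c + a) / 2) * rGamma ((c + 1 - a) / 2)"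
proof -
  have pos: "reg_hyp_half a (1 - a) c = 2 powr (1 - c) * of_real (sqrt pi) * rGamma ((c + a) / 2) * rGamma ((c + 1 - a) / 2)"
    if c: "Re c > 0" for c
  proof -
    define \<Phi> where "\<Phi> N = (\<Sum>k. pochhammer a k * pochhammer (1 - a) k / (pochhammer (c + of_nat N) k * fact k) * (1/2) ^ k)" for N
    have \<Phi>: "\<Phi> \<longlonglongrightarrow> 1"
      unfolding \<Phi>_def by (rule hypergeometric_tendsto_1) (use c in \<open>auto simp: norm_divide\<close>)
    define z where "z = (c + 1 - a) / 2"
    define w where "w = (c + a) / 2"
    define F where "F = reg_hyp_half a (1 - a) c"
    have nonpole: "c + of_nat k \<notin> \<int>\<^sub>\<le>\<^sub>0" for k
      using c by (auto elim!: nonpos_Ints_cases simp: complex_eq_iff)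
    have main: "F * (pochhammer (c/2) N * pochhammer (c/2 + 1/2) N) = rGamma c * (pochhammer z N * pochhammer w N) * \<Phi> (2 * N)" for N
    proof -
      have "rGamma c = pochhammer (2 * (c/2)) (2 * N) * rGamma (c + of_nat (2 * N))"
        using pochhammer_rGamma[of c "2 * N"] by simp
      also have "pochhammer (2 * (c/2)) (2 * N) = 4 ^ N * pochhammer (c/2) N * pochhammer (c/2 + 1/2) N"
        unfolding pochhammer_double by (simp add: power_mult)
      finally have 1: "rGamma c = 4 ^ N * pochhammer (c/2) N * pochhammer (c/2 + 1/2) N * rGamma (c + of_nat (2 * N))" .
      have "F = 4 ^ N * pochhammer z N * pochhammer w N * (rGamma (c + of_nat (2 * N)) * \<Phi> (2 * N))"
        unfolding F_def z_def w_def \<Phi>_def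
        by (subst reg_hyp_half_Bailey_rec_iter[of a c N], subst reg_hyp_half_eq_hypergeometric[OF nonpole]) simp
      then show ?thesis
        unfolding 1 by (simp add: mult_ac)
    qed
    \<comment> \<open>Euler's approximant \<open>rGamma_series\<close> of index \<open>N\<close> has
      \<open>N + 1\<close> Pochhammer factors, hence \<open>Suc N\<close>. Its other factors depend
      only on the sum of the two arguments, and \<open>c/2 + (c/2 + 1/2) = z + w\<close>, so they
      cancel.\<close>
    have ser: "F * (rGamma_series (c/2) N * rGamma_series (c/2 + 1/2) N)
        = rGamma c * (rGamma_series z N * rGamma_series w N) * \<Phi> (2 * Suc N)" for N
    proof -
      have prod: "rGamma_series x N * rGamma_series y N =
          pochhammer x (Suc N) * pochhammer y (Suc N) / (fact N ^ 2 * exp ((x + y) * of_real (ln (of_nat N))))" for x y :: complex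
        by (simp add: rGamma_series_def power2_eq_square ring_distribs exp_add mult_ac)
      have s: "c/2 + (c/2 + 1/2) = c + 1/2" "z + w = c + 1/2"
        by (simp_all add: z_def w_def field_simps)
      show ?thesis
        unfolding prod s using main[of "Suc N"] by (simp add: divide_simps)
    qed
    have "(\<lambda>N. F * (rGamma_series (c/2) N * rGamma_series (c/2 + 1/2) N)) \<longlonglongrightarrow> F * (rGamma (c/2) * rGamma (c/2 + 1/2))"
      by (intro tendsto_intros)
    moreover have "(\<lambda>N. \<Phi> (2 * Suc N)) \<longlonglongrightarrow> 1"
      using LIMSEQ_subseq_LIMSEQ[OF \<Phi>, of "\<lambda>N. 2 * Suc N"] by (simp add: strict_mono_def o_def)
    then have "(\<lambda>N. rGamma c * (rGamma_series z N * rGamma_series w N) * \<Phi> (2 * Suc N)) \<longlonglongrightarrow> rGamma c * (rGamma z * rGamma w) * 1"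
      by (intro tendsto_mult tendsto_const rGamma_series_LIMSEQ)
    ultimately have "F * (rGamma (c/2) * rGamma (c/2 + 1/2)) = rGamma c * (rGamma z * rGamma w)"
      unfolding ser mult_1_right by (rule LIMSEQ_unique)
    also have "rGamma c = 2 powr (1 - c) * of_real (sqrt pi) * (rGamma (c/2) * rGamma (c/2 + 1/2))"
      using rGamma_duplication[of "c/2"] by simp
    finally have "(F - 2 powr (1 - c) * of_real (sqrt pi) * (rGamma z * rGamma w)) * (rGamma (c/2) * rGamma (c/2 + 1/2)) = 0"
      by (simp add: algebra_simps)
    moreover have "c/2 \<notin> \<int>\<^sub>\<le>\<^sub>0" "c/2 + 1/2 \<notin> \<int>\<^sub>\<le>\<^sub>0"
      using c by (auto elim!: nonpos_Ints_cases simp: complex_eq_iff)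
    ultimately show ?thesis
      by (simp add: F_def z_def w_def rGamma_eq_zero_iff mult_ac)
  qed
  \<comment> \<open>The number \<open>n\<close> counts shifts of \<open>c\<close> by 2 that suffice
    to reach the half-plane \<open>Re c > 0\<close>; the induction walks back.\<close>
  obtain n :: nat where "- Re c < of_nat n"
    using reals_Archimedean2 by blast
  then have "Re c + 2 * of_nat n > 0" by linarith
  then show ?thesis
  proof (induction n arbitrary: c)
    case (Suc n)
    have "2 powr (1 - c) = (2 :: complex) powr (2 + (1 - (c + 2)))"
      by simp
    also have "\<dots> = 4 * 2 powr (1 - (c + 2))"
      by (subst powr_add) (simp add: powr_numeral)
    finally have p: "2 powr (1 - c) = 4 * (2 :: complex) powr (1 - (c + 2))" .
    have 1: "rGamma ((c + a) / 2) = (c + a) / 2 * rGamma ((c + 2 + a) / 2)"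
      using rGamma_plus1[of "(c + a) / 2"] by (simp add: field_simps)
    have 2: "rGamma ((c + 1 - a) / 2) = (c + 1 - a) / 2 * rGamma ((c + 2 + 1 - a) / 2)"
      using rGamma_plus1[of "(c + 1 - a) / 2"] by (simp add: field_simps)
    have 3: "reg_hyp_half a (1 - a) (c + 2) = 2 powr (1 - (c + 2)) * of_real (sqrt pi) * rGamma ((c + 2 + a) / 2) * rGamma ((c + 2 + 1 - a) / 2)"
      by (rule Suc.IH) (use Suc.prems in \<open>simp add: algebra_simps\<close>)
    have "(c + 1 - a) * (c + a) * (P * s * X * Y) = 4 * P * s * ((c + a) / 2 * X) * ((c + 1 - a) / 2 * Y)" for P s X Y
      by (simp add: field_simps)
    then show ?case
      unfolding reg_hyp_half_Bailey_rec[of a c] p 1 2 3 .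
  qed (use pos in auto)
qed

text \<open>Base case \<open>i = 0\<close> of both families. Duplication at
  \<open>(c + \<alpha>) / 2\<close> absorbs the power of 2 and the factor \<open>sqrt pi\<close>,
  and leaves a quotient of Gamma type as in the sums over \<open>r\<close>.\<close>

lemma reg_hyp_half_Bailey_Gamma:
  assumes "(c + \<alpha>) / 2 \<notin> \<int>\<^sub>\<le>\<^sub>0"
  shows "2 powr (- \<alpha>) * reg_hyp_half (- \<alpha>) (1 + \<alpha>) c = rGamma (c + \<alpha>) * (Gamma ((c + \<alpha>) / 2) * rGamma ((c - \<alpha>) / 2))"
proof -
  have "rGamma (c + \<alpha>) = 2 powr (1 - (c + \<alpha>)) * of_real (sqrt pi) * (rGamma ((c + \<alpha>) / 2) * rGamma ((c + 1 + \<alpha>) / 2))"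
    using rGamma_duplication[of "(c + \<alpha>) / 2"] by (simp add: add_divide_distrib add_ac)
  moreover have "rGamma ((c + \<alpha>) / 2) * Gamma ((c + \<alpha>) / 2) = 1"
    using assms by (simp add: rGamma_inverse_Gamma Gamma_eq_zero_iff)
  moreover have "(2 :: complex) powr (1 - (c + \<alpha>)) = 2 powr (- \<alpha>) * 2 powr (1 - c)"
    unfolding powr_add[symmetric] by (simp add: algebra_simps)
  ultimately show ?thesis
    using reg_hyp_half_Bailey[of "- \<alpha>" c] by (simp add: algebra_simps)
qed

section \<open>Induction on i by Pascal's rule\<close>

lemma sum_choose_Suc:
  fixes f :: "nat \<Rightarrow> 'a :: comm_semiring_1"
  shows "(\<Sum>r\<le>Suc i. of_nat (Suc i choose r) * f r) =
    (\<Sum>r\<le>i. of_nat (i choose r) * f r) + (\<Sum>r\<le>i. of_nat (i choose r) * f (Suc r))"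
proof -
  have "(\<Sum>r\<le>i. of_nat (i choose r) * f r) = (\<Sum>r\<le>Suc i. of_nat (i choose r) * f r)"
    by (simp add: binomial_eq_0)
  then show ?thesis
    unfolding sum.atMost_Suc_shift by (simp add: algebra_simps sum.distrib)
qed

text \<open>Induction with \<open>reg_hyp_half_raise_upper\<close>, whose factors
  \<open>of_nat i - \<alpha>\<close> accumulate to \<open>pochhammer (- \<alpha>) i\<close>. The
  functional equation of \<open>rGamma\<close> gives the sums at \<open>c - 1\<close> and
  \<open>c\<close> a common prefactor. The one at \<open>c\<close> supplies the summands with index
  \<open>r + 1\<close>; its minus sign turns into the alternating sign, and Pascal's rule merges the
  two.\<close>

lemma reg_hyp_half_contiguous_up:
  assumes "\<And>r. r \<le> i \<Longrightarrow> (c + \<alpha> - of_nat i + of_nat r) / 2 \<notin> \<int>\<^sub>\<le>\<^sub>0"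
  shows "2 powr (- \<alpha>) * pochhammer (- \<alpha>) i * reg_hyp_half (of_nat i - \<alpha>) (1 + \<alpha>) c =
    rGamma (c + \<alpha> - of_nat i) * (\<Sum>r\<le>i. of_nat (i choose r) *
      ((-1) ^ r * Gamma ((c + \<alpha> - of_nat i + of_nat r) / 2) * rGamma ((c - \<alpha> - of_nat i + of_nat r) / 2)))"
  using assms
proof (induction i arbitrary: c)
  case 0
  then show ?case
    using reg_hyp_half_Bailey_Gamma[of c \<alpha>] by simp
next
  case (Suc i)
  let ?S = "\<lambda>c. \<Sum>r\<le>i. of_nat (i choose r) *
      ((-1) ^ r * Gamma ((c + \<alpha> - of_nat i + of_nat r) / 2) * rGamma ((c - \<alpha> - of_nat i + of_nat r) / 2))"
  let ?p = "2 powr (- \<alpha>) * pochhammer (- \<alpha>) i"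
  have IH1: "?p * reg_hyp_half (of_nat i - \<alpha>) (1 + \<alpha>) (c - 1) = rGamma (c - 1 + \<alpha> - of_nat i) * ?S (c - 1)"
  proof (rule Suc.IH)
    fix r assume "r \<le> i"
    then show "(c - 1 + \<alpha> - of_nat i + of_nat r) / 2 \<notin> \<int>\<^sub>\<le>\<^sub>0"
      using Suc.prems[of r] by (simp add: algebra_simps)
  qed
  have IH2: "?p * reg_hyp_half (of_nat i - \<alpha>) (1 + \<alpha>) c = rGamma (c + \<alpha> - of_nat i) * ?S c"
  proof (rule Suc.IH)
    fix r assume "r \<le> i"
    then show "(c + \<alpha> - of_nat i + of_nat r) / 2 \<notin> \<int>\<^sub>\<le>\<^sub>0"
      using Suc.prems[of "Suc r"] by (simp add: algebra_simps)
  qed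
  have G: "(c - 1 - (of_nat i - \<alpha>)) * rGamma (c + \<alpha> - of_nat i) = rGamma (c - 1 + \<alpha> - of_nat i)"
    using rGamma_plus1[of "c - 1 + \<alpha> - of_nat i"] by (simp add: algebra_simps)
  have "2 powr (- \<alpha>) * pochhammer (- \<alpha>) (Suc i) * reg_hyp_half (of_nat (Suc i) - \<alpha>) (1 + \<alpha>) c
      = ?p * ((of_nat i - \<alpha>) * reg_hyp_half (of_nat i - \<alpha> + 1) (1 + \<alpha>) c)"
    by (simp add: pochhammer_Suc algebra_simps)
  also have "\<dots> = ?p * reg_hyp_half (of_nat i - \<alpha>) (1 + \<alpha>) (c - 1)
      - (c - 1 - (of_nat i - \<alpha>)) * (?p * reg_hyp_half (of_nat i - \<alpha>) (1 + \<alpha>) c)"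
    unfolding reg_hyp_half_raise_upper by (simp add: algebra_simps)
  also have "\<dots> = rGamma (c - 1 + \<alpha> - of_nat i) * (?S (c - 1) - ?S c)"
    unfolding IH1 IH2 G[symmetric] by (simp only: right_diff_distrib mult.assoc)
  finally have fin: "2 powr (- \<alpha>) * pochhammer (- \<alpha>) (Suc i) * reg_hyp_half (of_nat (Suc i) - \<alpha>) (1 + \<alpha>) c
      = rGamma (c - 1 + \<alpha> - of_nat i) * (?S (c - 1) - ?S c)" .
  have arg: "c - 1 + \<alpha> - of_nat i = c + \<alpha> - of_nat (Suc i)"
    by simp
  have sums: "?S (c - 1) - ?S c = (\<Sum>r\<le>Suc i. of_nat (Suc i choose r) *
      ((-1) ^ r * Gamma ((c + \<alpha> - of_nat (Suc i) + of_nat r) / 2) * rGamma ((c - \<alpha> - of_nat (Suc i) + of_nat r) / 2)))"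
    unfolding sum_choose_Suc diff_conv_add_uminus[of "?S (c - 1)"] sum_negf[symmetric]
    by (intro arg_cong2[of _ _ _ _ "(+)"] sum.cong refl) (simp_all add: algebra_simps)
  show ?case
    unfolding fin sums unfolding arg ..
qed

text \<open>Induction with \<open>reg_hyp_half_lower_upper\<close>, generalised over \<alpha>
  because the step passes to \<open>\<alpha> + 1\<close> at \<open>c\<close> and
  \<open>c + 1\<close>. The factor 1/2 of that relation turns \<open>2 powr (- \<alpha>)\<close>
  into \<open>2 powr (- (\<alpha> + 1))\<close>. Both contributions enter with a plus sign, so the
  sum does not alternate.\<close>

lemma reg_hyp_half_contiguous_down:
  assumes "\<And>r. r \<le> i \<Longrightarrow> (c + \<alpha> + of_nat r + of_nat i) / 2 \<notin> \<int>\<^sub>\<le>\<^sub>0"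
  shows "2 powr (- \<alpha>) * reg_hyp_half (- \<alpha> - of_nat i) (1 + \<alpha>) c =
    rGamma (c + \<alpha> + of_nat i) * (\<Sum>r\<le>i. of_nat (i choose r) *
      (Gamma ((c + \<alpha> + of_nat r + of_nat i) / 2) * rGamma ((c - \<alpha> + of_nat r - of_nat i) / 2)))"
  using assms
proof (induction i arbitrary: c \<alpha>)
  case 0
  then show ?case
    using reg_hyp_half_Bailey_Gamma[of c \<alpha>] by simp
next
  case (Suc i)
  let ?S = "\<lambda>\<alpha> c. \<Sum>r\<le>i. of_nat (i choose r) *
      (Gamma ((c + \<alpha> + of_nat r + of_nat i) / 2) * rGamma ((c - \<alpha> + of_nat r - of_nat i) / 2))"
  let ?F = "reg_hyp_half (- \<alpha> - of_nat (Suc i)) (1 + \<alpha> + 1)"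
  have e: "- (\<alpha> + 1) - of_nat i = - \<alpha> - of_nat (Suc i)" "1 + (\<alpha> + 1) = 1 + \<alpha> + 1"
    by simp_all
  have IH1: "2 powr (- (\<alpha> + 1)) * ?F c = rGamma (c + (\<alpha> + 1) + of_nat i) * ?S (\<alpha> + 1) c"
    unfolding e[symmetric]
  proof (rule Suc.IH)
    fix r assume "r \<le> i"
    then show "(c + (\<alpha> + 1) + of_nat r + of_nat i) / 2 \<notin> \<int>\<^sub>\<le>\<^sub>0"
      using Suc.prems[of r] by (simp add: algebra_simps)
  qed
  have IH2: "2 powr (- (\<alpha> + 1)) * ?F (c + 1) = rGamma (c + 1 + (\<alpha> + 1) + of_nat i) * ?S (\<alpha> + 1) (c + 1)"
    unfolding e[symmetric]
  proof (rule Suc.IH)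
    fix r assume "r \<le> i"
    then show "(c + 1 + (\<alpha> + 1) + of_nat r + of_nat i) / 2 \<notin> \<int>\<^sub>\<le>\<^sub>0"
      using Suc.prems[of "Suc r"] by (simp add: algebra_simps)
  qed
  have G: "(c - (- \<alpha> - of_nat (Suc i))) * rGamma (c + 1 + (\<alpha> + 1) + of_nat i) = rGamma (c + (\<alpha> + 1) + of_nat i)"
    using rGamma_plus1[of "c + (\<alpha> + 1) + of_nat i"] by (simp add: algebra_simps)
  have p: "(2 :: complex) powr (- \<alpha>) / 2 = 2 powr (- (\<alpha> + 1))"
    by (simp add: powr_diff)
  have "2 powr (- \<alpha>) * reg_hyp_half (- \<alpha> - of_nat (Suc i)) (1 + \<alpha>) c
     = 2 powr (- \<alpha>) / 2 * ?F c + (c - (- \<alpha> - of_nat (Suc i))) * (2 powr (- \<alpha>) / 2 * ?F (c + 1))"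
    by (subst reg_hyp_half_lower_upper) (simp add: field_simps)
  also have "\<dots> = rGamma (c + (\<alpha> + 1) + of_nat i) * ?S (\<alpha> + 1) c
     + (c - (- \<alpha> - of_nat (Suc i))) * (rGamma (c + 1 + (\<alpha> + 1) + of_nat i) * ?S (\<alpha> + 1) (c + 1))"
    unfolding p IH1 IH2 by simp
  also have "\<dots> = rGamma (c + (\<alpha> + 1) + of_nat i) * (?S (\<alpha> + 1) c + ?S (\<alpha> + 1) (c + 1))"
    unfolding G[symmetric] by (simp only: distrib_left mult.assoc)
  finally have fin: "2 powr (- \<alpha>) * reg_hyp_half (- \<alpha> - of_nat (Suc i)) (1 + \<alpha>) c
      = rGamma (c + (\<alpha> + 1) + of_nat i) * (?S (\<alpha> + 1) c + ?S (\<alpha> + 1) (c + 1))" .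
  have arg: "c + (\<alpha> + 1) + of_nat i = c + \<alpha> + of_nat (Suc i)"
    by simp
  have sums: "?S (\<alpha> + 1) c + ?S (\<alpha> + 1) (c + 1) = (\<Sum>r\<le>Suc i. of_nat (Suc i choose r) *
      (Gamma ((c + \<alpha> + of_nat r + of_nat (Suc i)) / 2) * rGamma ((c - \<alpha> + of_nat r - of_nat (Suc i)) / 2)))"
    unfolding sum_choose_Suc
    by (intro arg_cong2[of _ _ _ _ "(+)"] sum.cong refl) (simp_all add: algebra_simps)
  show ?case
    unfolding fin sums unfolding arg ..
qed

section \<open>Bounded variation in the shifted parameter\<close>

lemma of_nat_le_norm_shift:
  fixes \<beta> :: "'a :: real_normed_field"
  assumes "\<beta> \<notin> \<int>\<^sub>\<le>\<^sub>0"
  obtains K where "K > 0" "\<And>j. 1 + real j \<le> K * norm (\<beta> + of_nat j)"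
proof -
  have "Bseq (\<lambda>j. (1 + of_nat j) / (\<beta> + of_nat j))"
    using shifted_ratio_tendsto_1[of 1 \<beta>] by (intro convergent_imp_Bseq convergentI)
  then obtain K where K: "K > 0" "\<And>j. norm ((1 + of_nat j) / (\<beta> + of_nat j)) \<le> K"
    by (auto simp: Bseq_def)
  have "1 + real j \<le> K * norm (\<beta> + of_nat j)" for j
  proof -
    have "norm (1 + of_nat j :: 'a) = 1 + real j"
      using norm_of_nat[of "Suc j", where 'a='a] by simp
    moreover have "norm (\<beta> + of_nat j) > 0"
      using nonpos_Ints_add_of_nat_neq_0[OF assms] by simp
    ultimately show ?thesis
      using K(2)[of j] by (simp add: norm_divide field_simps)
  qed
  with K(1) show ?thesis using that by blast
qed

text \<open>Each factor of the quotient is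
  \<open>1 + (\<alpha> - \<beta>) / (\<beta> + n + m)\<close>, of norm at most
  \<open>1 + K / (1 + m)\<close> for every \<open>n\<close>. The product of these bounds is
  \<open>(1+K)_m / m!\<close>, of polynomial growth in \<open>m\<close>.\<close>

lemma pochhammer_quotient_bound:
  fixes \<alpha> \<beta> :: "'a :: real_normed_field"
  assumes "\<beta> \<notin> \<int>\<^sub>\<le>\<^sub>0"
  obtains K where "K \<ge> 0"
    "\<And>n m. norm (pochhammer (\<alpha> + of_nat n) m / pochhammer (\<beta> + of_nat n) m) \<le> pochhammer (1 + K) m / fact m"
proof -
  obtain K0 where K0: "K0 > 0" "\<And>j. 1 + real j \<le> K0 * norm (\<beta> + of_nat j)"
    using of_nat_le_norm_shift[OF assms] by blast
  define K where "K = norm (\<alpha> - \<beta>) * K0"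
  have K: "K \<ge> 0" using K0 by (simp add: K_def)
  have factor: "norm ((\<alpha> + of_nat n + of_nat m) / (\<beta> + of_nat n + of_nat m)) \<le> (1 + K + real m) / (1 + real m)" for n m
  proof -
    let ?d = "\<beta> + of_nat n + of_nat m"
    have d: "?d \<noteq> 0" using nonpos_Ints_add_of_nat_neq_0[OF assms, of "n + m"] by (simp add: add.assoc)
    have "1 + real m \<le> K0 * norm ?d"
      using K0(2)[of "n + m"] by (simp add: add.assoc)
    then have "norm (\<alpha> - \<beta>) * (1 + real m) \<le> norm (\<alpha> - \<beta>) * (K0 * norm ?d)"
      by (intro mult_left_mono) auto
    then have "norm (\<alpha> - \<beta>) / norm ?d \<le> K / (1 + real m)"
      using d by (simp add: K_def field_simps)
    moreover have "(\<alpha> + of_nat n + of_nat m) / ?d = 1 + (\<alpha> - \<beta>) / ?d"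
      using d by (simp add: field_simps)
    then have "norm ((\<alpha> + of_nat n + of_nat m) / ?d) \<le> 1 + norm (\<alpha> - \<beta>) / norm ?d"
      using norm_triangle_ineq[of 1 "(\<alpha> - \<beta>) / ?d"] by (simp add: norm_divide)
    moreover have "1 + K / (1 + real m) = (1 + K + real m) / (1 + real m)"
      by (simp add: field_simps)
    ultimately show ?thesis by linarith
  qed
  have "norm (pochhammer (\<alpha> + of_nat n) m / pochhammer (\<beta> + of_nat n) m) \<le> pochhammer (1 + K) m / fact m" for n m
  proof (induction m)
    case (Suc m)
    have "norm (pochhammer (\<alpha> + of_nat n) (Suc m) / pochhammer (\<beta> + of_nat n) (Suc m))
        = norm (pochhammer (\<alpha> + of_nat n) m / pochhammer (\<beta> + of_nat n) m)
          * norm ((\<alpha> + of_nat n + of_nat m) / (\<beta> + of_nat n + of_nat m))"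
      by (simp add: pochhammer_Suc norm_mult norm_divide)
    also have "\<dots> \<le> (pochhammer (1 + K) m / fact m) * ((1 + K + real m) / (1 + real m))"
      using K by (intro mult_mono Suc.IH factor) (auto intro!: divide_nonneg_nonneg pochhammer_nonneg)
    also have "\<dots> = pochhammer (1 + K) (Suc m) / fact (Suc m)"
      by (simp add: pochhammer_Suc mult_ac)
    finally show ?case .
  qed simp
  with K show ?thesis using that by blast
qed

lemma sum_inverse_squares_bounded:
  obtains Z :: real where "Z \<ge> 0" "\<And>N. (\<Sum>n<N. 1 / (1 + real n)\<^sup>2) \<le> Z"
proof -
  have "summable (\<lambda>n. 1 / (1 + real n)\<^sup>2)"
    using summable_Suc_iff[THEN iffD2, OF inverse_power_summable[of 2, where 'a=real]]
    by (simp add: inverse_eq_divide)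
  then have "0 \<le> (\<Sum>n. 1 / (1 + real n)\<^sup>2)" "(\<Sum>n<N. 1 / (1 + real n)\<^sup>2) \<le> (\<Sum>n. 1 / (1 + real n)\<^sup>2)" for N
    by (auto intro!: sum_le_suminf suminf_nonneg)
  then show ?thesis by (rule that)
qed

text \<open>For fixed \<open>m\<close>, passing from \<open>n\<close> to \<open>n + 1\<close>
  produces a difference of order \<open>m / n^2\<close> times the size of the quotient, which is
  summable over \<open>n\<close>. The extra factor \<open>m\<close> is paid for by raising the
  parameter \<open>1 + K\<close> to \<open>2 + K\<close>.\<close>

lemma pochhammer_quotient_variation:
  fixes \<alpha> \<beta> :: "'a :: real_normed_field"
  assumes "\<beta> \<notin> \<int>\<^sub>\<le>\<^sub>0"
  obtains C K where "C \<ge> 0" "K \<ge> 0"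
    "\<And>n m. norm (pochhammer (\<alpha> + of_nat n) m / pochhammer (\<beta> + of_nat n) m) \<le> C * (pochhammer (2 + K) m / fact m)"
    "\<And>N m. (\<Sum>n<N. norm (pochhammer (\<alpha> + of_nat (Suc n)) m / pochhammer (\<beta> + of_nat (Suc n)) m
        - pochhammer (\<alpha> + of_nat n) m / pochhammer (\<beta> + of_nat n) m)) \<le> C * (pochhammer (2 + K) m / fact m)"
proof -
  obtain K0 where K0: "K0 > 0" "\<And>j. 1 + real j \<le> K0 * norm (\<beta> + of_nat j)"
    using of_nat_le_norm_shift[OF assms] by blast
  obtain K where K: "K \<ge> 0"
    "\<And>n m. norm (pochhammer (\<alpha> + of_nat n) m / pochhammer (\<beta> + of_nat n) m) \<le> pochhammer (1 + K) m / fact m"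
    using pochhammer_quotient_bound[OF assms] by blast
  obtain Z :: real where Z: "Z \<ge> 0" "\<And>N. (\<Sum>n<N. 1 / (1 + real n)\<^sup>2) \<le> Z"
    using sum_inverse_squares_bounded by blast
  define D where "D = norm (\<beta> - \<alpha>) * K0\<^sup>2 * Z"
  define \<phi> where "\<phi> m n = pochhammer (\<alpha> + of_nat n) m / pochhammer (\<beta> + of_nat n) m" for m n
  have D: "D \<ge> 0" using Z by (simp add: D_def)
  have inv: "1 / norm (\<beta> + of_nat j) \<le> K0 / (1 + real j)" for j
    using K0 nonpos_Ints_add_of_nat_neq_0[OF assms, of j] by (simp add: divide_simps mult.commute)
  \<comment> \<open>The quotients at \<open>n\<close> and at \<open>n + 1\<close> share all factors
    but one, the last one and the first one respectively; the common part is
    \<open>\<phi> k (Suc n)\<close>.\<close>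
  have diff: "\<phi> (Suc k) (Suc n) - \<phi> (Suc k) n = \<phi> k (Suc n) * (of_nat (Suc k) * (\<beta> - \<alpha>) / ((\<beta> + of_nat n) * (\<beta> + of_nat (n + Suc k))))" for k n
  proof -
    have nz: "\<beta> + of_nat n \<noteq> 0" "\<beta> + of_nat (n + Suc k) \<noteq> 0" for n
      using nonpos_Ints_add_of_nat_neq_0[OF assms] by blast+
    have 1: "\<phi> (Suc k) (Suc n) = \<phi> k (Suc n) * ((\<alpha> + of_nat (n + Suc k)) / (\<beta> + of_nat (n + Suc k)))"
      by (simp add: \<phi>_def pochhammer_Suc add_ac)
    have 2: "\<phi> (Suc k) n = \<phi> k (Suc n) * ((\<alpha> + of_nat n) / (\<beta> + of_nat n))"
      by (simp add: \<phi>_def pochhammer_rec add_ac mult.commute)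
    have 3: "(\<alpha> + of_nat (n + Suc k)) / (\<beta> + of_nat (n + Suc k)) - (\<alpha> + of_nat n) / (\<beta> + of_nat n)
        = of_nat (Suc k) * (\<beta> - \<alpha>) / ((\<beta> + of_nat n) * (\<beta> + of_nat (n + Suc k)))"
      using nz by (simp add: divide_simps del: of_nat_Suc of_nat_add) (simp add: algebra_simps)
    show ?thesis
      unfolding 1 2 3[symmetric] by (simp add: right_diff_distrib)
  qed
  have var: "(\<Sum>n<N. norm (\<phi> m (Suc n) - \<phi> m n)) \<le> real m * D * (pochhammer (1 + K) m / fact m)" for N m
  proof (cases m)
    case (Suc k)
    have mono: "pochhammer (1 + K) k / fact k \<le> pochhammer (1 + K) m / fact m"
    proof -
      have "pochhammer (1 + K) k / fact k * 1 \<le> pochhammer (1 + K) k / fact k * ((1 + K + real k) / (1 + real k))"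
        using K(1) by (intro mult_left_mono) (auto intro!: divide_nonneg_nonneg pochhammer_nonneg)
      then show ?thesis by (simp add: Suc pochhammer_Suc mult_ac)
    qed
    have "norm (\<phi> m (Suc n) - \<phi> m n) \<le> (pochhammer (1 + K) m / fact m) * (real m * norm (\<beta> - \<alpha>) * K0\<^sup>2) * (1 / (1 + real n)\<^sup>2)" for n
    proof -
      have "norm (\<phi> m (Suc n) - \<phi> m n) = norm (\<phi> k (Suc n)) * (real m * norm (\<beta> - \<alpha>)
          * (1 / norm (\<beta> + of_nat n) * (1 / norm (\<beta> + of_nat (n + Suc k)))))"
        unfolding Suc diff by (simp add: norm_mult norm_divide del: of_nat_Suc of_nat_add)
      also have "\<dots> \<le> (pochhammer (1 + K) m / fact m) * (real m * norm (\<beta> - \<alpha>) * ((K0 / (1 + real n)) * (K0 / (1 + real n))))"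
      proof (intro mult_mono order_refl)
        show "norm (\<phi> k (Suc n)) \<le> pochhammer (1 + K) m / fact m"
          unfolding \<phi>_def by (rule order_trans[OF K(2) mono])
        have "K0 / (1 + real (n + Suc k)) \<le> K0 / (1 + real n)"
          using K0 by (intro divide_left_mono) auto
        then show "1 / norm (\<beta> + of_nat (n + Suc k)) \<le> K0 / (1 + real n)"
          using inv[of "n + Suc k"] by linarith
      qed (use inv K0 K(1) in \<open>auto intro!: divide_nonneg_nonneg pochhammer_nonneg\<close>)
      also have "\<dots> = (pochhammer (1 + K) m / fact m) * (real m * norm (\<beta> - \<alpha>) * K0\<^sup>2) * (1 / (1 + real n)\<^sup>2)"
        by (simp add: power2_eq_square)
      finally show ?thesis .
    qed
    then have "(\<Sum>n<N. norm (\<phi> m (Suc n) - \<phi> m n)) \<le>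
        (\<Sum>n<N. (pochhammer (1 + K) m / fact m) * (real m * norm (\<beta> - \<alpha>) * K0\<^sup>2) * (1 / (1 + real n)\<^sup>2))"
      by (intro sum_mono)
    also have "\<dots> \<le> (pochhammer (1 + K) m / fact m) * (real m * norm (\<beta> - \<alpha>) * K0\<^sup>2) * Z"
      unfolding sum_distrib_left[symmetric] using K(1)
      by (intro mult_left_mono Z) (auto intro!: mult_nonneg_nonneg divide_nonneg_nonneg pochhammer_nonneg)
    finally show ?thesis
      by (simp add: D_def mult_ac)
  qed (simp add: \<phi>_def)
  define C where "C = (1 + D) * (1 + K)"
  \<comment> \<open>The absorption rests on
    \<open>(1 + K + m) (1+K)_m = (1 + K) (2+K)_m\<close>.\<close>
  have raise: "(1 + real m * D) * (pochhammer (1 + K) m / fact m) \<le> C * (pochhammer (2 + K) m / fact m)" for m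
  proof -
    have "0 \<le> D * K" "0 \<le> D * real m" using D K by auto
    then have "1 + real m * D \<le> (1 + D) * (1 + K + real m)"
      using D K by (simp add: algebra_simps)
    then have "(1 + real m * D) * pochhammer (1 + K) m \<le> (1 + D) * (1 + K + real m) * pochhammer (1 + K) m"
      using K by (intro mult_right_mono) (auto intro!: pochhammer_nonneg)
    also have "\<dots> = (1 + D) * ((1 + K) * pochhammer (1 + K + 1) m)"
      using pochhammer_rec[of "1 + K" m] pochhammer_Suc[of "1 + K" m] by (simp add: mult.commute)
    finally show ?thesis
      by (simp add: C_def divide_right_mono add_ac mult.assoc)
  qed
  have nonneg: "0 \<le> pochhammer (1 + K) m / fact m" "0 \<le> real m * D * (pochhammer (1 + K) m / fact m)" for m
    using K D by (auto intro!: divide_nonneg_nonneg mult_nonneg_nonneg pochhammer_nonneg)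
  show ?thesis
  proof
    show "C \<ge> 0" "K \<ge> 0" using K D by (auto simp: C_def)
    fix N n m
    have *: "(1 + real m * D) * (pochhammer (1 + K) m / fact m)
        = pochhammer (1 + K) m / fact m + real m * D * (pochhammer (1 + K) m / fact m)"
      by (simp only: distrib_right mult_1)
    show "norm (pochhammer (\<alpha> + of_nat n) m / pochhammer (\<beta> + of_nat n) m) \<le> C * (pochhammer (2 + K) m / fact m)"
      using K(2)[of n m] raise[of m] nonneg[of m] * by linarith
    show "(\<Sum>n<N. norm (pochhammer (\<alpha> + of_nat (Suc n)) m / pochhammer (\<beta> + of_nat (Suc n)) m
        - pochhammer (\<alpha> + of_nat n) m / pochhammer (\<beta> + of_nat n) m)) \<le> C * (pochhammer (2 + K) m / fact m)"
      using var[of m N] raise[of m] nonneg[of m] * unfolding \<phi>_def by linarith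
  qed
qed

text \<open>Shifting the lower parameter changes its reciprocal Pochhammer symbol by
  \<open>- k / (\<beta> + n)_(k+1)\<close>. For \<open>k > 0\<close> at least two factors of the
  denominator grow with \<open>n\<close>, which gives the decay \<open>1 / (1 + n)^2\<close>; for
  \<open>k = 0\<close> the change is zero.\<close>

lemma hypergeometric_shift_variation:
  fixes a b \<beta> :: complex
  assumes "\<beta> \<notin> \<int>\<^sub>\<le>\<^sub>0"
  defines "g \<equiv> \<lambda>n w. \<Sum>k. pochhammer a k * pochhammer b k / (pochhammer (\<beta> + of_nat n) k * fact k) * w ^ k"
  obtains G where "\<And>n w. norm w \<le> 1/2 \<Longrightarrow> norm (g n w) \<le> G"
    "\<And>n w. norm w \<le> 1/2 \<Longrightarrow> norm (g (Suc n) w - g n w) \<le> G * (1 / (1 + real n)\<^sup>2)"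
proof -
  obtain K where K: "K \<ge> 0"
    "\<And>n m. norm (pochhammer (1 + of_nat n) m / pochhammer (\<beta> + of_nat n) m) \<le> pochhammer (1 + K) m / fact m"
    using pochhammer_quotient_bound[OF assms(1), of 1] by blast
  \<comment> \<open>One majorant for both estimates: two of the three factorials come from bounding
    the reciprocal Pochhammer symbol, and the index \<open>Suc k\<close> serves the difference,
    whose denominator has one factor more.\<close>
  define M where "M k = pochhammer (norm a) k * pochhammer (norm b) k * pochhammer (1 + K) (Suc k) / fact k ^ 3 * (1/2) ^ k" for k
  have nonpole: "\<beta> + of_nat n \<notin> \<int>\<^sub>\<le>\<^sub>0" for n
    using assms(1) by (rule nonpos_Ints_add_of_nat)
  have inv: "1 / norm (pochhammer (\<beta> + of_nat n) k) \<le> pochhammer (1 + K) k / (fact k * pochhammer (1 + real n) k)" for n k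
  proof -
    have pos: "0 < pochhammer (1 + real n) k" by (rule pochhammer_pos) simp
    have nz: "0 < norm (pochhammer (\<beta> + of_nat n) k)" using pochhammer_nonzero[OF nonpole] by simp
    have "pochhammer (1 + real n) k \<le> norm (pochhammer (1 + of_nat n :: complex) k)"
      using norm_pochhammer_ge_Re[of "1 + of_nat n" k] by simp
    then have "pochhammer (1 + real n) k / norm (pochhammer (\<beta> + of_nat n) k) \<le> pochhammer (1 + K) k / fact k"
      using K(2)[of n k] nz by (simp add: norm_divide) (meson divide_right_mono norm_ge_zero order_trans)
    then show ?thesis
      using pos nz by (simp add: field_simps)
  qed
  have summable_M: "summable M"
  proof -
    let ?R = "\<lambda>k. (norm a + of_nat k) / (1 + of_nat k) * ((norm b + of_nat k) / (1 + of_nat k)) * ((2 + K + of_nat k) / (1 + of_nat k)) * (1/2)"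
    have "summable (\<lambda>k. norm (M k))"
    proof (rule summable_norm_ratio_limit)
      show "?R \<longlonglongrightarrow> 1 * 1 * 1 * (1/2)"
        by (intro tendsto_intros shifted_ratio_tendsto_1)
      show "eventually (\<lambda>k. M (Suc k) = M k * ?R k) sequentially"
        by (intro always_eventually allI)
           (simp add: M_def pochhammer_Suc power3_eq_cube mult_ac add_ac)
    qed simp
    then show ?thesis by (rule summable_norm_cancel)
  qed
  have coef: "norm (pochhammer a k * pochhammer b k / fact k * w ^ k) \<le> pochhammer (norm a) k * pochhammer (norm b) k / fact k * (1/2) ^ k"
    if "norm w \<le> 1/2" for w k
    unfolding norm_mult norm_divide norm_power
    by (intro mult_mono divide_mono norm_pochhammer_le power_mono) (use that in \<open>auto simp: pochhammer_norm_nonneg\<close>)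
  have step_le: "pochhammer (1 + K) k \<le> pochhammer (1 + K) (Suc k)" for k
  proof -
    have "pochhammer (1 + K) k * 1 \<le> pochhammer (1 + K) k * (1 + K + real k)"
      using K by (intro mult_left_mono pochhammer_nonneg) auto
    then show ?thesis by (simp add: pochhammer_Suc)
  qed
  have K1: "0 \<le> pochhammer (1 + K) k" for k using K by (intro pochhammer_nonneg) auto
  let ?t = "\<lambda>n w k. pochhammer a k * pochhammer b k / (pochhammer (\<beta> + of_nat n) k * fact k) * w ^ k"
  have bound: "norm (?t n w k) \<le> M k" if w: "norm w \<le> 1/2" for n w k
  proof -
    have "1 / norm (pochhammer (\<beta> + of_nat n) k) \<le> pochhammer (1 + K) (Suc k) / (fact k * fact k)"
    proof -
      have "fact k \<le> pochhammer (1 + real n) k"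
        unfolding pochhammer_fact pochhammer_prod by (intro prod_mono) auto
      then have "pochhammer (1 + K) k / (fact k * pochhammer (1 + real n) k) \<le> pochhammer (1 + K) (Suc k) / (fact k * fact k)"
        by (intro frac_le step_le K1 mult_left_mono) auto
      then show ?thesis using inv[of n k] by linarith
    qed
    then have "norm (pochhammer a k * pochhammer b k / fact k * w ^ k) * (1 / norm (pochhammer (\<beta> + of_nat n) k))
       \<le> (pochhammer (norm a) k * pochhammer (norm b) k / fact k * (1/2) ^ k) * (pochhammer (1 + K) (Suc k) / (fact k * fact k))"
      by (intro mult_mono coef w) (auto intro!: mult_nonneg_nonneg divide_nonneg_nonneg simp: pochhammer_norm_nonneg)
    then show ?thesis
      by (simp add: M_def norm_mult norm_divide power3_eq_cube mult_ac)
  qed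
  have diff: "norm (?t (Suc n) w k - ?t n w k) \<le> M k * (1 / (1 + real n)\<^sup>2)" if w: "norm w \<le> 1/2" for n w k
  proof -
    let ?p = "pochhammer (\<beta> + of_nat n) (Suc k)"
    have nz: "\<beta> + of_nat n \<noteq> 0" "\<beta> + of_nat n + of_nat k \<noteq> 0" "pochhammer (\<beta> + of_nat n) k \<noteq> 0" "pochhammer (\<beta> + of_nat n + 1) k \<noteq> 0"
      using nonpos_Ints_add_of_nat_neq_0[OF nonpole[of n], of 0] nonpos_Ints_add_of_nat_neq_0[OF nonpole[of n], of k]
        pochhammer_nonzero[OF nonpole[of n]] pochhammer_nonzero[OF nonpole[of "Suc n"]] by (auto simp: add_ac)
    have "1 / pochhammer (\<beta> + of_nat (Suc n)) k = (\<beta> + of_nat n) / ?p"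
      using nz by (simp add: pochhammer_rec add_ac)
    moreover have "1 / pochhammer (\<beta> + of_nat n) k = (\<beta> + of_nat n + of_nat k) / ?p"
      using nz by (simp add: pochhammer_Suc)
    ultimately have "1 / pochhammer (\<beta> + of_nat (Suc n)) k - 1 / pochhammer (\<beta> + of_nat n) k = - (of_nat k / ?p)"
      by (simp add: diff_divide_distrib[symmetric])
    moreover have "?t (Suc n) w k - ?t n w k = (pochhammer a k * pochhammer b k / fact k * w ^ k)
        * (1 / pochhammer (\<beta> + of_nat (Suc n)) k - 1 / pochhammer (\<beta> + of_nat n) k)"
      by (simp add: right_diff_distrib mult_ac)
    ultimately have eq: "norm (?t (Suc n) w k - ?t n w k) = norm (pochhammer a k * pochhammer b k / fact k * w ^ k) * (real k / norm ?p)"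
      by (simp add: norm_mult norm_divide)
    have "real k / norm ?p \<le> pochhammer (1 + K) (Suc k) / (fact k * fact k) * (1 / (1 + real n)\<^sup>2)"
    proof (cases k)
      case (Suc j)
      \<comment> \<open>The first two factors of \<open>(1+n)_(k+1)\<close> supply
        \<open>(1 + n)^2\<close>, and the remaining \<open>k - 1\<close> factors have product at
        least \<open>2 * 3 * ... * k = k!\<close>.\<close>
      have "(fact k :: real) = pochhammer 2 j"
        using pochhammer_rec[of "1::real" j] by (simp add: Suc pochhammer_fact)
      also have "\<dots> \<le> pochhammer (3 + real n) j"
        unfolding pochhammer_prod by (intro prod_mono) auto
      finally have "(1 + real n) * (1 + real n) * fact k \<le> (1 + real n) * (2 + real n) * pochhammer (3 + real n) j"
        by (intro mult_mono) auto
      also have "\<dots> = pochhammer (1 + real n) (Suc k)"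
        by (simp add: Suc pochhammer_rec add_ac)
      finally have ge: "(1 + real n)\<^sup>2 * fact k \<le> pochhammer (1 + real n) (Suc k)"
        by (simp add: power2_eq_square)
      have "real k / norm ?p = real k * (1 / norm ?p)" by simp
      also have "\<dots> \<le> real k * (pochhammer (1 + K) (Suc k) / (fact (Suc k) * pochhammer (1 + real n) (Suc k)))"
        by (intro mult_left_mono inv) auto
      also have "\<dots> \<le> real k * (pochhammer (1 + K) (Suc k) / (fact (Suc k) * ((1 + real n)\<^sup>2 * fact k)))"
        using ge K1 by (intro mult_left_mono frac_le) auto
      also have "\<dots> = (real k / (1 + real k)) * (pochhammer (1 + K) (Suc k) / (fact k * ((1 + real n)\<^sup>2 * fact k)))"
        by simp
      also have "\<dots> \<le> 1 * (pochhammer (1 + K) (Suc k) / (fact k * ((1 + real n)\<^sup>2 * fact k)))"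
        using K1 by (intro mult_right_mono divide_nonneg_nonneg) auto
      finally show ?thesis by (simp add: mult_ac)
    qed (use K in auto)
    then have "norm (?t (Suc n) w k - ?t n w k) \<le> (pochhammer (norm a) k * pochhammer (norm b) k / fact k * (1/2) ^ k)
        * (pochhammer (1 + K) (Suc k) / (fact k * fact k) * (1 / (1 + real n)\<^sup>2))"
      unfolding eq by (intro mult_mono coef w) (auto intro!: mult_nonneg_nonneg divide_nonneg_nonneg simp: pochhammer_norm_nonneg)
    then show ?thesis
      by (simp add: M_def power3_eq_cube mult_ac)
  qed
  have st: "summable (\<lambda>k. norm (?t n w k))" if "norm w \<le> 1/2" for n w
    by (rule summable_norm_hypergeometric[OF nonpole]) (use that in auto)
  show ?thesis
  proof
    fix n and w :: complex assume w: "norm w \<le> 1/2"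
    have "norm (g n w) \<le> (\<Sum>k. norm (?t n w k))"
      unfolding g_def by (rule summable_norm[OF st[OF w]])
    also have "\<dots> \<le> (\<Sum>k. M k)"
      by (rule suminf_le[OF bound[OF w] st[OF w] summable_M])
    finally show "norm (g n w) \<le> (\<Sum>k. M k)" .
    have sM: "summable (\<lambda>k. M k * (1 / (1 + real n)\<^sup>2))"
      by (rule summable_mult2[OF summable_M])
    have sd: "summable (\<lambda>k. norm (?t (Suc n) w k - ?t n w k))"
      by (rule summable_comparison_test'[OF sM]) (use diff[OF w] in auto)
    have gd: "g (Suc n) w - g n w = (\<Sum>k. ?t (Suc n) w k - ?t n w k)"
      unfolding g_def by (rule suminf_diff[OF st[OF w, THEN summable_norm_cancel] st[OF w, THEN summable_norm_cancel]])
    have "norm (g (Suc n) w - g n w) \<le> (\<Sum>k. norm (?t (Suc n) w k - ?t n w k))"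
      unfolding gd by (rule summable_norm[OF sd])
    also have "\<dots> \<le> (\<Sum>k. M k * (1 / (1 + real n)\<^sup>2))"
      by (rule suminf_le[OF diff[OF w] sd sM])
    also have "\<dots> = (\<Sum>k. M k) * (1 / (1 + real n)\<^sup>2)"
      by (rule suminf_mult2[OF summable_M, symmetric])
    finally show "norm (g (Suc n) w - g n w) \<le> (\<Sum>k. M k) * (1 / (1 + real n)\<^sup>2)" .
  qed
qed

section \<open>Well-poised coefficient sums\<close>

text \<open>The very-well-poised factor is \<open>1 + 2 n / \<alpha>\<close>. The constant part is
  Vandermonde's sum. In the linear part \<open>n\<close> is absorbed into the binomial coefficient,
  leaving Vandermonde's sum with \<open>c + 1\<close>, \<open>d + 1\<close> and
  \<open>q - 1\<close>. Together they give the linear factor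
  \<open>\<beta> (\<alpha> + q) / \<alpha>\<close>.\<close>

lemma sum_well_poised_terminating:
  fixes \<alpha> \<beta> :: "'a :: field_char_0"
  defines "c \<equiv> 1 + (\<alpha> + \<beta>) / 2" and "d \<equiv> (\<alpha> - \<beta>) / 2"
  assumes c: "c \<notin> \<int>\<^sub>\<le>\<^sub>0" and \<alpha>: "\<alpha> \<noteq> 0"
  shows "(\<Sum>n\<le>q. (-1) ^ n * of_nat (q choose n) * ((\<alpha> + 2 * of_nat n) / \<alpha> * (pochhammer d n / pochhammer c n)))
    = pochhammer \<beta> q * (\<alpha> + of_nat q) / (\<alpha> * pochhammer c q)"
proof (cases q)
  case 0
  then show ?thesis using \<alpha> by simp
next
  case (Suc k)
  have c1: "c + 1 \<notin> \<int>\<^sub>\<le>\<^sub>0"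
    using c using nonpos_Ints_add_of_nat[of c 1] by simp
  let ?f = "\<lambda>n. (-1) ^ n * of_nat (q choose n) * (pochhammer d n / pochhammer c n)"
  have "(\<Sum>n\<le>q. of_nat n * ?f n) = (\<Sum>n\<le>k. of_nat (Suc n) * ?f (Suc n))"
    unfolding Suc by (simp add: sum.atMost_Suc_shift del: sum.atMost_Suc)
  also have "\<dots> = (\<Sum>n\<le>k. - (of_nat q * d / c) * ((-1) ^ n * of_nat (k choose n) * (pochhammer (d + 1) n / pochhammer (c + 1) n)))"
  proof (intro sum.cong refl)
    fix n
    have "of_nat (Suc n) * of_nat (q choose Suc n) = (of_nat q * of_nat (k choose n) :: 'a)"
      unfolding Suc of_nat_mult[symmetric] by (simp only: Suc_times_binomial)
    moreover have "of_nat (Suc n) * ?f (Suc n) = (of_nat (Suc n) * of_nat (q choose Suc n)) * ((-1) ^ Suc n * (pochhammer d (Suc n) / pochhammer c (Suc n)))"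
      by (simp only: mult_ac)
    ultimately have "of_nat (Suc n) * ?f (Suc n) = of_nat q * of_nat (k choose n) * ((-1) ^ Suc n * (pochhammer d (Suc n) / pochhammer c (Suc n)))"
      by (simp only:)
    then show "of_nat (Suc n) * ?f (Suc n) = - (of_nat q * d / c) * ((-1) ^ n * of_nat (k choose n) * (pochhammer (d + 1) n / pochhammer (c + 1) n))"
      by (simp add: pochhammer_rec mult_ac)
  qed
  also have "\<dots> = - (of_nat q * d / c) * (pochhammer (c - d) k / pochhammer (c + 1) k)"
    using binomial_pochhammer_Vandermonde[OF c1, of k "d + 1"] by (simp only: sum_distrib_left[symmetric] add_diff_add diff_self add_0_right)
  finally have S1: "(\<Sum>n\<le>q. of_nat n * ?f n) = - (of_nat q * d) * pochhammer (c - d) k / pochhammer c q"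
    by (simp add: Suc pochhammer_rec)
  have S0: "(\<Sum>n\<le>q. ?f n) = pochhammer (c - d) k * (c - d + of_nat k) / pochhammer c q"
    using binomial_pochhammer_Vandermonde[OF c, of q d] by (simp add: Suc pochhammer_Suc)
  have "(\<Sum>n\<le>q. (-1) ^ n * of_nat (q choose n) * ((\<alpha> + 2 * of_nat n) / \<alpha> * (pochhammer d n / pochhammer c n)))
      = (\<Sum>n\<le>q. ?f n + 2 / \<alpha> * (of_nat n * ?f n))"
    using \<alpha> by (intro sum.cong refl) (simp add: add_divide_distrib algebra_simps)
  also have "\<dots> = (\<Sum>n\<le>q. ?f n) + 2 / \<alpha> * (\<Sum>n\<le>q. of_nat n * ?f n)"
    by (simp only: sum.distrib sum_distrib_left)
  also have "\<dots> = pochhammer (c - d) k / pochhammer c q * (c - d + of_nat k - 2 / \<alpha> * of_nat q * d)"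
    unfolding S0 S1 by (simp add: right_diff_distrib mult_ac)
  also have "c - d + of_nat k - 2 / \<alpha> * of_nat q * d = \<beta> * (\<alpha> + of_nat q) / \<alpha>"
    using \<alpha> by (simp add: c_def d_def Suc field_simps)
  also have "c - d = \<beta> + 1"
    by (simp add: c_def d_def field_simps)
  finally show ?thesis
    by (simp only: Suc pochhammer_rec[of \<beta>]) (simp add: mult_ac)
qed

text \<open>Vandermonde expands \<open>(\<beta> - b)_(p-n) / (\<beta> + n)_(p-n)\<close> into a sum
  over \<open>k\<close>. Regrouping by \<open>q = n + k\<close> makes the dependence on
  \<open>b\<close> factor out, and the inner sum over \<open>n\<close> is the terminating
  well-poised one.\<close>

lemma sum_well_poised_convolution:
  fixes \<alpha> \<beta> b :: "'a :: field_char_0"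
  defines "c \<equiv> 1 + (\<alpha> + \<beta>) / 2" and "d \<equiv> (\<alpha> - \<beta>) / 2"
  assumes c: "c \<notin> \<int>\<^sub>\<le>\<^sub>0" and \<alpha>: "\<alpha> \<noteq> 0" and \<beta>: "\<beta> \<notin> \<int>\<^sub>\<le>\<^sub>0"
  shows "(\<Sum>n\<le>p. of_nat (p choose n) * (pochhammer b n * pochhammer (\<beta> - b) (p - n) / pochhammer \<beta> p)
           * ((\<alpha> + 2 * of_nat n) / \<alpha> * (pochhammer d n / pochhammer c n)))
    = (\<Sum>q\<le>p. (-1) ^ q * of_nat (p choose q) * (pochhammer b q * (\<alpha> + of_nat q) / (\<alpha> * pochhammer c q)))"
proof -
  define D where "D n = (\<alpha> + 2 * of_nat n) / \<alpha> * (pochhammer d n / pochhammer c n)" for n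
  define f where "f n k = of_nat (p choose n) * D n * ((-1) ^ k * of_nat ((p - n) choose k) * (pochhammer b (n + k) / pochhammer \<beta> (n + k)))" for n k
  have bn: "\<beta> + of_nat n \<notin> \<int>\<^sub>\<le>\<^sub>0" for n
    using \<beta> by (rule nonpos_Ints_add_of_nat)
  have row: "of_nat (p choose n) * (pochhammer b n * pochhammer (\<beta> - b) (p - n) / pochhammer \<beta> p) * D n = (\<Sum>k\<le>p - n. f n k)"
    if "n \<le> p" for n
  proof -
    have "pochhammer (\<beta> - b) (p - n) / pochhammer (\<beta> + of_nat n) (p - n)
        = (\<Sum>k\<le>p - n. (-1) ^ k * of_nat ((p - n) choose k) * (pochhammer (b + of_nat n) k / pochhammer (\<beta> + of_nat n) k))"
      using binomial_pochhammer_Vandermonde[OF bn[of n], of "p - n" "b + of_nat n"] by simp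
    then have "of_nat (p choose n) * D n * (pochhammer b n / pochhammer \<beta> n) * (pochhammer (\<beta> - b) (p - n) / pochhammer (\<beta> + of_nat n) (p - n))
        = (\<Sum>k\<le>p - n. f n k)"
      by (simp add: f_def sum_distrib_left pochhammer_product' mult_ac)
    then show ?thesis
      by (simp add: pochhammer_product[OF that, of \<beta>] mult_ac)
  qed
  have "(\<Sum>n\<le>p. of_nat (p choose n) * (pochhammer b n * pochhammer (\<beta> - b) (p - n) / pochhammer \<beta> p) * D n)
      = (\<Sum>n\<le>p. \<Sum>k\<le>p - n. f n k)"
    by (intro sum.cong refl row) auto
  also have "\<dots> = (\<Sum>(n, k)\<in>(SIGMA n:{..p}. {..p - n}). f n k)"
    by (simp add: sum.Sigma)
  also have "(SIGMA n:{..p}. {..p - n}) = {(n, k). n + k \<le> p}"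
    by auto
  also have "(\<Sum>(n, k)\<in>{(n, k). n + k \<le> p}. f n k) = (\<Sum>q\<le>p. \<Sum>n\<le>q. f n (q - n))"
    by (rule sum.triangle_reindex_eq)
  also have "\<dots> = (\<Sum>q\<le>p. (-1) ^ q * of_nat (p choose q) * (pochhammer b q * (\<alpha> + of_nat q) / (\<alpha> * pochhammer c q)))"
  proof (intro sum.cong refl)
    fix q assume "q \<in> {..p}"
    then have q: "q \<le> p" by simp
    have "f n (q - n) = (-1) ^ q * of_nat (p choose q) * (pochhammer b q / pochhammer \<beta> q) * ((-1) ^ n * of_nat (q choose n) * D n)"
      if n: "n \<le> q" for n
    proof -
      \<comment> \<open>Trinomial revision is what separates the outer index \<open>q\<close> from
        the inner index \<open>n\<close>.\<close>
      have "(of_nat (p choose n) * of_nat ((p - n) choose (q - n)) :: 'a) = of_nat (p choose q) * of_nat (q choose n)"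
        using choose_mult[OF n q] by (simp flip: of_nat_mult)
      moreover have "((-1) ^ (q - n) :: 'a) = (-1) ^ q * (-1) ^ n"
        using n by (simp add: minus_one_power_iff even_diff_nat)
      moreover have "f n (q - n) = (of_nat (p choose n) * of_nat ((p - n) choose (q - n))) * D n * ((-1) ^ (q - n) * (pochhammer b q / pochhammer \<beta> q))"
        using n by (simp add: f_def)
      ultimately show ?thesis by (simp only: mult_ac)
    qed
    then have "(\<Sum>n\<le>q. f n (q - n)) = (-1) ^ q * of_nat (p choose q) * (pochhammer b q / pochhammer \<beta> q) * (\<Sum>n\<le>q. (-1) ^ n * of_nat (q choose n) * D n)"
      by (simp add: sum_distrib_left)
    also have "(\<Sum>n\<le>q. (-1) ^ n * of_nat (q choose n) * D n) = pochhammer \<beta> q * (\<alpha> + of_nat q) / (\<alpha> * pochhammer c q)"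
      unfolding D_def c_def d_def by (rule sum_well_poised_terminating) (use c \<alpha> c_def in auto)
    finally show "(\<Sum>n\<le>q. f n (q - n)) = (-1) ^ q * of_nat (p choose q) * (pochhammer b q * (\<alpha> + of_nat q) / (\<alpha> * pochhammer c q))"
      using pochhammer_nonzero[OF \<beta>, of q] by simp
  qed
  finally show ?thesis
    unfolding D_def .
qed

section \<open>Passage to the boundary point 1\<close>

lemma continuous_on_unit_interval_eq_at_1:
  fixes f g :: "real \<Rightarrow> 'a :: t2_space"
  assumes "continuous_on {0..1} f" "continuous_on {0..1} g" "\<And>x. 0 \<le> x \<Longrightarrow> x < 1 \<Longrightarrow> f x = g x"
  shows "f 1 = g 1"
proof (rule tendsto_unique)
  show "at_left (1::real) \<noteq> bot" by simp
  show "(f \<longlongrightarrow> f 1) (at_left 1)"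
    using assms(1) by (auto simp: continuous_on_def at_within_Icc_at_left dest!: bspec[of _ _ 1])
  have "(g \<longlongrightarrow> g 1) (at_left 1)"
    using assms(2) by (auto simp: continuous_on_def at_within_Icc_at_left dest!: bspec[of _ _ 1])
  moreover have "eventually (\<lambda>x. g x = f x) (at_left (1::real))"
    by (rule eventually_at_leftI[of 0]) (use assms(3) in auto)
  ultimately show "(f \<longlongrightarrow> g 1) (at_left 1)"
    by (rule Lim_transform_eventually)
qed

text \<open>Abel's theorem as an instance of the bounded variation criterion: on
  \<open>[0, 1]\<close> the powers of \<open>x\<close> decrease in the exponent, so their total
  variation telescopes to at most 1.\<close>

lemma continuous_on_Abel_sum:
  fixes s :: "nat \<Rightarrow> complex"
  assumes "summable s"
  shows "continuous_on {0..1} (\<lambda>x::real. \<Sum>m. s m * of_real x ^ m)"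
proof (rule uniform_limit_theorem)
  show "uniform_limit {0..1} (\<lambda>N x. \<Sum>m<N. s m * of_real x ^ m) (\<lambda>x::real. \<Sum>m. s m * of_real x ^ m) sequentially"
  proof (rule uniform_limit_bounded_variation[OF assms])
    fix x :: real assume x: "x \<in> {0..1}"
    fix N
    show "norm (of_real x ^ N :: complex) \<le> 1"
      using x by (simp add: norm_power power_le_one)
    have "norm (of_real x ^ Suc n - of_real x ^ n :: complex) = x ^ n - x ^ Suc n" for n
    proof -
      have "x ^ Suc n \<le> x ^ n" using x by (intro power_decreasing) auto
      moreover have "of_real x ^ Suc n - of_real x ^ n = (of_real (x ^ Suc n - x ^ n) :: complex)" by simp
      ultimately show ?thesis by (simp only: norm_of_real)
    qed
    then show "(\<Sum>n<N. norm (of_real x ^ Suc n - of_real x ^ n :: complex)) \<le> 1"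
      using x sum_lessThan_telescope'[of "\<lambda>n. x ^ n" N] by simp
  qed
qed (auto intro!: always_eventually continuous_intros)

lemma minus_divide_minus_minus_one:
  fixes z :: "'a :: field"
  shows "- z / (- z - 1) = z / (1 + z)"
proof -
  have "- z - 1 = - (1 + z)" by simp
  then show ?thesis by (simp only: minus_divide_divide)
qed

lemma norm_divide_one_plus_le_half:
  assumes "0 \<le> x" "x \<le> 1"
  shows "norm (of_real x / (1 + of_real x) :: complex) \<le> 1 / 2"
proof -
  have "(of_real x / (1 + of_real x) :: complex) = of_real (x / (1 + x))" by simp
  then have "norm (of_real x / (1 + of_real x) :: complex) = \<bar>x / (1 + x)\<bar>"
    by (simp only: norm_of_real)
  also have "\<dots> \<le> 1 / 2" using assms by (simp add: divide_simps)
  finally show ?thesis .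
qed

section \<open>Reduction of the double series\<close>

text \<open>The reduction depends on the two numerator parameters only through the relation
  \<open>a + b = \<beta>\<close>; keeping \<open>b\<close> free covers both families of the theorem
  and every \<open>i\<close> at once.\<close>

locale well_poised_kdf =
  fixes \<alpha> \<beta> b :: complex
  assumes \<beta>: "\<beta> \<notin> \<int>\<^sub>\<le>\<^sub>0" and \<alpha>: "\<alpha> / 2 \<notin> \<int>\<^sub>\<le>\<^sub>0" and c: "1 + (\<alpha> + \<beta>) / 2 \<notin> \<int>\<^sub>\<le>\<^sub>0"
begin

abbreviation c where "c \<equiv> 1 + (\<alpha> + \<beta>) / 2"
abbreviation d where "d \<equiv> (\<alpha> - \<beta>) / 2"
abbreviation a where "a \<equiv> \<beta> - b"

abbreviation kdf_summand where
  "kdf_summand \<equiv> kdf_term [\<alpha>] [a] [b, 1 + \<alpha> / 2, d] [\<beta>] [] [\<alpha> / 2, c] (-1) (-1)"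

definition D where "D n = (\<alpha> + 2 * of_nat n) / \<alpha> * (pochhammer d n / pochhammer c n)"

text \<open>This is the row \<open>m = 0\<close> of the double series, since
  \<open>h n 0 = 1\<close>.\<close>

definition e where "e n = (-1) ^ n * (pochhammer \<alpha> n / pochhammer \<beta> n) * (pochhammer b n / fact n) * D n"

definition h where "h n m = pochhammer a m / fact m * (pochhammer (\<alpha> + of_nat n) m / pochhammer (\<beta> + of_nat n) m)"

text \<open>The Gauss series \<open>F(a, \<beta> - \<alpha>; \<beta> + n; w)\<close>, which Pfaff's
  transformation makes out of the power series with coefficients \<open>h n m\<close>.\<close>

definition g where
  "g n w = (\<Sum>k. pochhammer a k * pochhammer (\<beta> - \<alpha>) k / (pochhammer (\<beta> + of_nat n) k * fact k) * w ^ k)"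

lemma \<alpha>_nonzero: "\<alpha> \<noteq> 0" using \<alpha> by auto

lemma \<beta>_shift: "\<beta> + of_nat n \<notin> \<int>\<^sub>\<le>\<^sub>0"
  using \<beta> by (rule nonpos_Ints_add_of_nat)

lemma kdf_summand_eq: "kdf_summand m n = (-1) ^ m * (e n * h n m)"
proof -
  have "\<alpha> / 2 * pochhammer (1 + \<alpha> / 2) n = pochhammer (\<alpha> / 2) n * (\<alpha> / 2 + of_nat n)"
    using pochhammer_rec[of "\<alpha> / 2" n] pochhammer_Suc[of "\<alpha> / 2" n] by (simp add: add.commute)
  then have "pochhammer (1 + \<alpha> / 2) n / pochhammer (\<alpha> / 2) n = (\<alpha> + 2 * of_nat n) / \<alpha>"
    using \<alpha>_nonzero pochhammer_nonzero[OF \<alpha>, of n] by (simp add: field_simps)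
  then have D: "D n = (pochhammer (1 + \<alpha> / 2) n / pochhammer (\<alpha> / 2) n) * (pochhammer d n / pochhammer c n)"
    by (simp add: D_def)
  show ?thesis
    unfolding e_def h_def D kdf_term_def add.commute[of m n]
    by (simp add: pochhammer_product' mult_ac)
qed

text \<open>Pfaff's transformation, with Vandermonde identifying
  \<open>(\<alpha> + n)_p / (\<beta> + n)_p\<close> as the binomial transform of
  \<open>(\<beta> - \<alpha>)_k / (\<beta> + n)_k\<close>. The new argument
  \<open>x / (1 + x)\<close> stays at most 1/2 even as \<open>x\<close> tends to 1.\<close>

lemma h_sum:
  assumes x: "0 \<le> x" "x < 1"
  shows "(\<lambda>m. h n m * (- of_real x) ^ m) sums
    ((1 + of_real x) powr (- a) * g n (of_real x / (1 + of_real x)))"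
proof -
  define v where "v k = pochhammer (\<beta> - \<alpha>) k / pochhammer (\<beta> + of_nat n) k" for k
  have u: "(\<Sum>q\<le>p. (-1) ^ q * of_nat (p choose q) * v q) = pochhammer (\<alpha> + of_nat n) p / pochhammer (\<beta> + of_nat n) p" for p
    unfolding v_def using binomial_pochhammer_Vandermonde[OF \<beta>_shift[of n], of p "\<beta> - \<alpha>"] by (simp add: algebra_simps)
  have su: "summable (\<lambda>m. pochhammer a m / fact m * (pochhammer (\<alpha> + of_nat n) m / pochhammer (\<beta> + of_nat n) m) * z ^ m)"
    if "norm z < 1" for z
    using summable_norm_cancel[OF summable_norm_hypergeometric[OF \<beta>_shift[of n] that, of a "\<alpha> + of_nat n"]]
    by (simp add: mult_ac)
  have sv: "summable (\<lambda>m. pochhammer a m / fact m * v m * z ^ m)" if "norm z < 1" for z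
    using summable_norm_cancel[OF summable_norm_hypergeometric[OF \<beta>_shift[of n] that, of a "\<beta> - \<alpha>"]]
    by (simp add: v_def mult_ac)
  have w: "- of_real x / (- of_real x - 1 :: complex) = of_real x / (1 + of_real x)"
    by (rule minus_divide_minus_minus_one)
  have "(\<Sum>m. pochhammer a m / fact m * (pochhammer (\<alpha> + of_nat n) m / pochhammer (\<beta> + of_nat n) m) * (- of_real x) ^ m) =
     (1 - (- of_real x)) powr (- a) * (\<Sum>q. pochhammer a q / fact q * v q * (- of_real x / (- of_real x - 1)) ^ q)"
    unfolding u[symmetric] by (rule Pfaff_transform) (use sv su u x in auto)
  moreover have "pochhammer a q / fact q * v q = pochhammer a q * pochhammer (\<beta> - \<alpha>) q / (pochhammer (\<beta> + of_nat n) q * fact q)" for q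
    by (simp add: v_def mult_ac)
  ultimately have "(\<Sum>m. h n m * (- of_real x) ^ m) = (1 + of_real x) powr (- a) * g n (of_real x / (1 + of_real x))"
    unfolding h_def g_def w by (simp only: diff_minus_eq_add)
  then show ?thesis
    using su[of "- of_real x"] x unfolding h_def by (simp add: sums_iff)
qed

lemma h_variation:
  obtains V where "\<And>m. V m \<ge> 0" "\<And>n m. norm (h n m) \<le> V m"
    "\<And>N m. (\<Sum>n<N. norm (h (Suc n) m - h n m)) \<le> V m"
    "\<And>x. 0 \<le> x \<Longrightarrow> x < 1 \<Longrightarrow> summable (\<lambda>m. V m * x ^ m)"
proof -
  obtain C K where CK: "C \<ge> 0" "K \<ge> 0"
    "\<And>n m. norm (pochhammer (\<alpha> + of_nat n) m / pochhammer (\<beta> + of_nat n) m) \<le> C * (pochhammer (2 + K) m / fact m)"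
    "\<And>N m. (\<Sum>n<N. norm (pochhammer (\<alpha> + of_nat (Suc n)) m / pochhammer (\<beta> + of_nat (Suc n)) m
        - pochhammer (\<alpha> + of_nat n) m / pochhammer (\<beta> + of_nat n) m)) \<le> C * (pochhammer (2 + K) m / fact m)"
    using pochhammer_quotient_variation[OF \<beta>, of \<alpha>] by blast
  define A where "A m = pochhammer (norm a) m / fact m" for m
  have A: "norm (pochhammer a m / fact m) \<le> A m" "0 \<le> A m" for m
    by (auto simp: A_def norm_divide norm_pochhammer_le pochhammer_norm_nonneg divide_right_mono)
  let ?V = "\<lambda>m. A m * (C * (pochhammer (2 + K) m / fact m))"
  have nn: "0 \<le> C * (pochhammer (2 + K) m / fact m)" for m
    using CK by (auto intro!: mult_nonneg_nonneg divide_nonneg_nonneg pochhammer_nonneg)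
  show ?thesis
  proof
    fix m n N
    show "0 \<le> ?V m" by (intro mult_nonneg_nonneg A nn)
    show "norm (h n m) \<le> ?V m"
      unfolding h_def norm_mult by (intro mult_mono A CK) auto
    have "h (Suc n) m - h n m = pochhammer a m / fact m * (pochhammer (\<alpha> + of_nat (Suc n)) m / pochhammer (\<beta> + of_nat (Suc n)) m
        - pochhammer (\<alpha> + of_nat n) m / pochhammer (\<beta> + of_nat n) m)" for n
      by (simp only: h_def right_diff_distrib)
    then have "(\<Sum>n<N. norm (h (Suc n) m - h n m)) = norm (pochhammer a m / fact m) *
       (\<Sum>n<N. norm (pochhammer (\<alpha> + of_nat (Suc n)) m / pochhammer (\<beta> + of_nat (Suc n)) m
        - pochhammer (\<alpha> + of_nat n) m / pochhammer (\<beta> + of_nat n) m))"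
      by (simp only: norm_mult sum_distrib_left)
    also have "\<dots> \<le> ?V m"
      by (intro mult_mono A CK) (auto intro: sum_nonneg)
    finally show "(\<Sum>n<N. norm (h (Suc n) m - h n m)) \<le> ?V m" .
  next
    fix x :: real assume x: "0 \<le> x" "x < 1"
    have "(1::real) \<notin> \<int>\<^sub>\<le>\<^sub>0" by (auto elim!: nonpos_Ints_cases)
    \<comment> \<open>Up to the constant \<open>C\<close>, the bound \<open>V m * x ^ m\<close> is
      the general term of a Gauss series with lower parameter 1.\<close>
    from summable_norm_cancel[OF summable_norm_hypergeometric[OF this, of x "norm a" "2 + K"]]
    have "summable (\<lambda>m. C * (pochhammer (norm a) m * pochhammer (2 + K) m / (pochhammer 1 m * fact m) * x ^ m))"
      using x by (intro summable_mult) simp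
    then show "summable (\<lambda>m. ?V m * x ^ m)"
      unfolding A_def pochhammer_fact[symmetric] by (simp add: mult_ac)
  qed
qed

lemma g_variation:
  obtains G where "\<And>n w. norm w \<le> 1/2 \<Longrightarrow> norm (g n w) \<le> G"
    "\<And>n w. norm w \<le> 1/2 \<Longrightarrow> norm (g (Suc n) w - g n w) \<le> G * (1 / (1 + real n)\<^sup>2)"
  using hypergeometric_shift_variation[OF \<beta>, of a "\<beta> - \<alpha>"] unfolding g_def by blast

text \<open>Summability of \<open>e\<close> alone gives uniform convergence up to the boundary of
  the square: the multipliers \<open>y^n g_n\<close> are bounded, and their variation is at most
  \<open>G * Z\<close> from the change of \<open>g\<close> plus \<open>G\<close> from the
  telescoping powers of \<open>y\<close>.\<close>

lemma weighted_g_continuous: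
  assumes e: "summable e"
  shows "continuous_on ({0..1} \<times> {0..1}) (\<lambda>(x::real, y::real). \<Sum>n. e n * (of_real y ^ n * g n (of_real x / (1 + of_real x))))"
proof -
  obtain G where G: "\<And>n w. norm w \<le> 1/2 \<Longrightarrow> norm (g n w) \<le> G"
    "\<And>n w. norm w \<le> 1/2 \<Longrightarrow> norm (g (Suc n) w - g n w) \<le> G * (1 / (1 + real n)\<^sup>2)"
    by (rule g_variation) blast
  obtain Z :: real where Z: "Z \<ge> 0" "\<And>N. (\<Sum>n<N. 1 / (1 + real n)\<^sup>2) \<le> Z"
    using sum_inverse_squares_bounded by blast
  have "norm (g 0 0) \<le> G" by (rule G) simp
  then have G0: "G \<ge> 0" using norm_ge_zero order_trans by blast
  let ?w = "\<lambda>x::real. of_real x / (1 + of_real x) :: complex"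
  have w: "norm (?w x) \<le> 1/2" if "0 \<le> x" "x \<le> 1" for x
    using that by (rule norm_divide_one_plus_le_half)
  let ?l = "\<lambda>n p. of_real (snd p) ^ n * g n (?w (fst p)) :: complex"
  let ?X = "{0..1::real} \<times> {0..1::real}"
  have "uniform_limit ?X (\<lambda>N p. \<Sum>n<N. e n * ?l n p) (\<lambda>p. \<Sum>n. e n * ?l n p) sequentially"
  proof (rule uniform_limit_bounded_variation[OF e, where V="G * Z + G"])
    fix p N assume "p \<in> ?X"
    then obtain x y where p: "p = (x, y)" "0 \<le> x" "x \<le> 1" "0 \<le> y" "y \<le> 1" by auto
    have y1: "norm (of_real y ^ n :: complex) \<le> 1" for n
      using p by (simp add: norm_power power_le_one)
    have "norm (?l N p) \<le> 1 * G"
      unfolding norm_mult p(1) fst_conv snd_conv by (intro mult_mono y1 G w) (use p in auto)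
    also have "\<dots> \<le> G * Z + G" using G0 Z by simp
    finally show "norm (?l N p) \<le> G * Z + G" .
    have "norm (?l (Suc n) p - ?l n p) \<le> G * (1 / (1 + real n)\<^sup>2) + (y ^ n - y ^ Suc n) * G" for n
    proof -
      have split: "?l (Suc n) p - ?l n p = of_real y ^ Suc n * (g (Suc n) (?w x) - g n (?w x)) + of_real (y ^ Suc n - y ^ n) * g n (?w x)"
        by (simp add: p algebra_simps)
      have 1: "norm (of_real y ^ Suc n * (g (Suc n) (?w x) - g n (?w x))) \<le> 1 * (G * (1 / (1 + real n)\<^sup>2))"
        unfolding norm_mult by (intro mult_mono y1 G w) (use p in auto)
      have yy: "y ^ Suc n \<le> y ^ n" using p by (intro power_decreasing) auto
      then have "norm (complex_of_real (y ^ Suc n - y ^ n)) = y ^ n - y ^ Suc n"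
        unfolding norm_of_real by linarith
      then have 2: "norm (of_real (y ^ Suc n - y ^ n) * g n (?w x)) \<le> (y ^ n - y ^ Suc n) * G"
        unfolding norm_mult using yy G(1)[OF w[OF p(2,3)], of n] by (simp only:) (intro mult_left_mono, auto)
      show ?thesis
        unfolding split using norm_triangle_mono[OF 1 2] by simp
    qed
    then have "(\<Sum>n<N. norm (?l (Suc n) p - ?l n p)) \<le> (\<Sum>n<N. G * (1 / (1 + real n)\<^sup>2) + (y ^ n - y ^ Suc n) * G)"
      by (intro sum_mono)
    also have "\<dots> = G * (\<Sum>n<N. 1 / (1 + real n)\<^sup>2) + (1 - y ^ N) * G"
      unfolding sum.distrib sum_distrib_left[symmetric] sum_distrib_right[symmetric]
      using sum_lessThan_telescope'[of "\<lambda>n. y ^ n" N] by simp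
    also have "\<dots> \<le> G * Z + 1 * G"
      using Z G0 p by (intro add_mono mult_left_mono mult_right_mono) auto
    finally show "(\<Sum>n<N. norm (?l (Suc n) p - ?l n p)) \<le> G * Z + G" by simp
  qed
  moreover have "continuous_on ?X (\<lambda>p. \<Sum>n<N. e n * ?l n p)" for N
  proof -
    have "isCont (g n) u" if "norm u \<le> 1/2" for n u
      unfolding g_def
    proof (rule isCont_powser[of _ "3/4"])
      show "summable (\<lambda>k. pochhammer a k * pochhammer (\<beta> - \<alpha>) k / (pochhammer (\<beta> + of_nat n) k * fact k) * (3/4) ^ k)"
        by (rule summable_norm_cancel[OF summable_norm_hypergeometric[OF \<beta>_shift]]) (simp add: norm_divide)
    qed (use that in \<open>simp add: norm_divide\<close>)
    then have gc: "continuous_on (cball 0 (1/2)) (g n)" for n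
      by (intro continuous_at_imp_continuous_on) auto
    have "continuous_on ?X (\<lambda>p. g n (?w (fst p)))" for n
    proof (rule continuous_on_compose2[OF gc])
      have "1 + complex_of_real x \<noteq> 0" if "0 \<le> x" for x
        using that by (simp add: complex_eq_iff)
      then show "continuous_on ?X (\<lambda>p. ?w (fst p))"
        by (intro continuous_intros) auto
    qed (use w in auto)
    then show ?thesis by (intro continuous_intros)
  qed
  ultimately have "continuous_on ?X (\<lambda>p. \<Sum>n. e n * ?l n p)"
    by (intro uniform_limit_theorem[where F=sequentially and f="\<lambda>N p. \<Sum>n<N. e n * ?l n p"]) auto
  then show ?thesis
    by (simp add: case_prod_unfold)
qed

text \<open>The two summations are exchanged without absolute convergence of the series of
  \<open>e\<close>. Truncating in \<open>n\<close> makes the exchange a finite one, and the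
  truncated inner sums are bounded by \<open>E * V m\<close> for every \<open>N\<close>, so
  Tannery's theorem removes the truncation.\<close>

lemma iterated_sum:
  assumes e: "summable e" and x: "0 \<le> x" "x < 1"
  shows "(\<Sum>m. (\<Sum>n. e n * h n m) * (- of_real x) ^ m) =
    (1 + of_real x) powr (- a) * (\<Sum>n. e n * g n (of_real x / (1 + of_real x)))"
proof -
  obtain V where V: "\<And>m. V m \<ge> 0" "\<And>n m. norm (h n m) \<le> V m"
    "\<And>N m. (\<Sum>n<N. norm (h (Suc n) m - h n m)) \<le> V m"
    "\<And>x. 0 \<le> x \<Longrightarrow> x < 1 \<Longrightarrow> summable (\<lambda>m. V m * x ^ m)"
    by (rule h_variation) blast
  obtain E where E: "\<And>V g N. (\<forall>n. norm (g n) \<le> V) \<Longrightarrow> (\<forall>N. (\<Sum>n<N. norm (g (Suc n) - g n)) \<le> V) \<Longrightarrow>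
      norm (\<Sum>n<N. e n * g n) \<le> E * V"
    using partial_sums_bounded_variation[OF e] by blast
  let ?z = "- of_real x :: complex"
  let ?P = "(1 + of_real x) powr (- a)" and ?w = "of_real x / (1 + of_real x) :: complex"
  have lim: "(\<lambda>N. \<Sum>n<N. e n * h n m) \<longlonglongrightarrow> (\<Sum>n. e n * h n m)" for m
    using uniform_limit_bounded_variation[OF e, of "{0::nat}" "\<lambda>n _. h n m" "V m"] V by simp
  have *: "(\<lambda>N. \<Sum>m. (\<Sum>n<N. e n * h n m) * ?z ^ m) \<longlonglongrightarrow> (\<Sum>m. (\<Sum>n. e n * h n m) * ?z ^ m)"
  proof (rule conjunct2[OF conjunct2[OF tannerys_theorem[where M="\<lambda>m. E * (V m * x ^ m)"]]])
    show "(\<lambda>N. (\<Sum>n<N. e n * h n m) * ?z ^ m) \<longlonglongrightarrow> (\<Sum>n. e n * h n m) * ?z ^ m" for m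
      by (intro tendsto_intros lim)
    have "norm ((\<Sum>n<N. e n * h n m) * ?z ^ m) \<le> E * (V m * x ^ m)" for N m
    proof -
      have "norm (\<Sum>n<N. e n * h n m) \<le> E * V m"
        by (rule E) (use V in auto)
      then have "norm (\<Sum>n<N. e n * h n m) * x ^ m \<le> E * V m * x ^ m"
        using x by (intro mult_right_mono) auto
      then show ?thesis using x by (simp add: norm_mult norm_power mult_ac)
    qed
    then show "\<forall>\<^sub>F (m, N) in sequentially \<times>\<^sub>F sequentially. norm ((\<Sum>n<N. e n * h n m) * ?z ^ m) \<le> E * (V m * x ^ m)"
      by (intro always_eventually) auto
    show "summable (\<lambda>m. E * (V m * x ^ m))"
      by (intro summable_mult V x)
  qed simp
  have "(\<Sum>m. (\<Sum>n<N. e n * h n m) * ?z ^ m) = ?P * (\<Sum>n<N. e n * g n ?w)" for N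
  proof -
    have "(\<lambda>m. \<Sum>n<N. e n * (h n m * ?z ^ m)) sums (\<Sum>n<N. e n * (?P * g n ?w))"
      by (intro sums_sum sums_mult h_sum x)
    then show ?thesis
      by (simp add: sums_iff sum_distrib_left sum_distrib_right mult_ac)
  qed
  with * have L: "(\<lambda>N. ?P * (\<Sum>n<N. e n * g n ?w)) \<longlonglongrightarrow> (\<Sum>m. (\<Sum>n. e n * h n m) * ?z ^ m)"
    by simp
  have "1 + complex_of_real x \<noteq> 0" using x by (simp add: complex_eq_iff)
  then have P: "?P \<noteq> 0" by simp
  from tendsto_mult[OF tendsto_const[of "inverse ?P"] L] P
  have "(\<lambda>n. e n * g n ?w) sums (inverse ?P * (\<Sum>m. (\<Sum>n. e n * h n m) * ?z ^ m))"
    by (simp add: sums_def mult.assoc[symmetric])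
  then have "(\<Sum>n. e n * g n ?w) = inverse ?P * (\<Sum>m. (\<Sum>n. e n * h n m) * ?z ^ m)"
    by (rule sums_unique[symmetric])
  then show ?thesis using P by (simp add: mult.assoc[symmetric])
qed

text \<open>For equal arguments below 1 the double series converges absolutely and may be summed by
  diagonals. The well-poised convolution shows that its coefficients are a binomial transform, to
  which Pfaff's transformation applies once more.\<close>

lemma diagonal_sum:
  assumes e: "summable e" and x: "0 \<le> x" "x < 1"
  shows "(1 + of_real x) powr (- a) * (\<Sum>n. e n * (of_real x ^ n * g n (of_real x / (1 + of_real x)))) =
    (1 + of_real x) powr (- \<alpha>) *
      (\<Sum>q. pochhammer b q * pochhammer (1 + \<alpha>) q / (pochhammer c q * fact q) * (of_real x / (1 + of_real x)) ^ q)"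
proof -
  obtain V where V: "\<And>m. V m \<ge> 0" "\<And>n m. norm (h n m) \<le> V m"
    "\<And>x. 0 \<le> x \<Longrightarrow> x < 1 \<Longrightarrow> summable (\<lambda>m. V m * x ^ m)"
    by (rule h_variation) blast
  from e have "Bseq e"
    by (intro convergent_imp_Bseq convergentI[OF summable_LIMSEQ_zero])
  then obtain E where E: "\<And>n. norm (e n) \<le> E" by (auto simp: Bseq_def)
  then have E0: "E \<ge> 0" using norm_ge_zero order_trans by blast
  define v where "v q = pochhammer b q * (\<alpha> + of_nat q) / (\<alpha> * pochhammer c q)" for q
  define u where "u p = (\<Sum>q\<le>p. (-1) ^ q * of_nat (p choose q) * v q)" for p
  \<comment> \<open>The factor \<open>(-1)^n\<close> contained in \<open>e n\<close> turns
    \<open>(-z)^n\<close> into \<open>z^n\<close>, so the diagonal \<open>n + m = p\<close> carries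
    the single power \<open>z^p\<close>.\<close>
  have diag: "(\<lambda>p. pochhammer \<alpha> p / fact p * u p * z ^ p) sums (\<Sum>n. \<Sum>m. e n * (-z) ^ n * (h n m * z ^ m))" if z: "norm z < 1" for z
  proof -
    let ?f = "\<lambda>n m. e n * (-z) ^ n * (h n m * z ^ m)"
    let ?S = "\<Sum>m. V m * norm z ^ m"
    have sV: "summable (\<lambda>m. E * norm z ^ n * (V m * norm z ^ m))" for n
      by (intro summable_mult V) (use z in auto)
    have le: "norm (?f n m) \<le> E * norm z ^ n * (V m * norm z ^ m)" for n m
      unfolding norm_mult norm_power norm_minus_cancel by (intro mult_mono E V(2)) (use E0 V(1) in auto)
    have s1: "summable (\<lambda>m. norm (?f n m))" for n
      by (rule summable_comparison_test'[OF sV]) (use le in auto)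
    have "(\<Sum>m. E * norm z ^ n * (V m * norm z ^ m)) = E * norm z ^ n * ?S" for n
      by (rule suminf_mult) (use V z in auto)
    then have le2: "(\<Sum>m. norm (?f n m)) \<le> E * norm z ^ n * ?S" for n
      using suminf_le[OF le s1 sV, of n] by (simp only:)
    have "summable (\<lambda>n. E * norm z ^ n * ?S)"
      by (intro summable_mult summable_mult2 summable_geometric) (use z in auto)
    then have s2: "summable (\<lambda>n. \<Sum>m. norm (?f n m))"
      by (rule summable_comparison_test') (use le2 suminf_nonneg[OF s1] in simp)
    have "(\<Sum>n\<le>p. ?f n (p - n)) = pochhammer \<alpha> p / fact p * u p * z ^ p" for p
    proof -
      have "?f n (p - n) = pochhammer \<alpha> p / fact p * (of_nat (p choose n) * (pochhammer b n * pochhammer a (p - n) / pochhammer \<beta> p) * D n) * z ^ p"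
        if n: "n \<le> p" for n
      proof -
        have "z ^ p = z ^ n * z ^ (p - n)" using n by (simp flip: power_add)
        moreover have "pochhammer \<alpha> p = pochhammer \<alpha> n * pochhammer (\<alpha> + of_nat n) (p - n)"
            "pochhammer \<beta> p = pochhammer \<beta> n * pochhammer (\<beta> + of_nat n) (p - n)"
          using pochhammer_product[OF n] by blast+
        moreover have "(of_nat (p choose n) :: complex) = fact p / (fact n * fact (p - n))"
          using n by (rule binomial_fact)
        ultimately show ?thesis
          unfolding e_def h_def power_minus[of z] by (simp add: mult_ac)
      qed
      then have "(\<Sum>n\<le>p. ?f n (p - n)) = pochhammer \<alpha> p / fact p * (\<Sum>n\<le>p. of_nat (p choose n) * (pochhammer b n * pochhammer a (p - n) / pochhammer \<beta> p) * D n) * z ^ p"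
        by (simp add: sum_distrib_left sum_distrib_right)
      then show ?thesis
        unfolding u_def v_def D_def sum_well_poised_convolution[OF c \<alpha>_nonzero \<beta>] .
    qed
    then show ?thesis using sums_diagonal[OF s1 s2] by simp
  qed
  have coef: "pochhammer \<alpha> q / fact q * v q = pochhammer b q * pochhammer (1 + \<alpha>) q / (pochhammer c q * fact q)" for q
  proof -
    have "pochhammer \<alpha> q * (\<alpha> + of_nat q) = \<alpha> * pochhammer (1 + \<alpha>) q"
      using pochhammer_rec[of \<alpha> q] pochhammer_Suc[of \<alpha> q] by (simp add: add.commute)
    then have "pochhammer (1 + \<alpha>) q = pochhammer \<alpha> q * (\<alpha> + of_nat q) / \<alpha>"
      using \<alpha>_nonzero by simp
    then show ?thesis by (simp add: v_def mult_ac)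
  qed
  have sv: "summable (\<lambda>q. pochhammer \<alpha> q / fact q * v q * z ^ q)" if "norm z < 1" for z
    unfolding coef by (rule summable_norm_cancel[OF summable_norm_hypergeometric[OF c that]])
  let ?z = "- of_real x :: complex"
  let ?P = "(1 + of_real x) powr (- a)" and ?w = "of_real x / (1 + of_real x) :: complex"
  have w: "?z / (?z - 1) = ?w"
    by (rule minus_divide_minus_minus_one)
  have "(\<Sum>p. pochhammer \<alpha> p / fact p * u p * ?z ^ p) =
     (1 - ?z) powr (- \<alpha>) * (\<Sum>q. pochhammer \<alpha> q / fact q * v q * (?z / (?z - 1)) ^ q)"
    unfolding u_def by (rule Pfaff_transform) (use sv sums_summable[OF diag] x u_def in auto)
  moreover have "(\<Sum>p. pochhammer \<alpha> p / fact p * u p * ?z ^ p) = (\<Sum>n. \<Sum>m. e n * (-?z) ^ n * (h n m * ?z ^ m))"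
    using diag[of ?z] x by (simp add: sums_iff)
  moreover have row: "(\<Sum>m. e n * (-?z) ^ n * (h n m * ?z ^ m)) = ?P * (e n * (of_real x ^ n * g n ?w))" for n
    using sums_mult[OF h_sum[OF x, of n], of "e n * (-?z) ^ n"] by (simp add: sums_iff mult_ac)
  moreover have "(\<Sum>n. ?P * (e n * (of_real x ^ n * g n ?w))) = ?P * (\<Sum>n. e n * (of_real x ^ n * g n ?w))"
  proof -
    obtain G' where G': "\<And>n w. norm w \<le> 1/2 \<Longrightarrow> norm (g n w) \<le> G'"
      by (rule g_variation) blast
    have "norm ?w \<le> 1/2" using x by (intro norm_divide_one_plus_le_half) auto
    then have G: "norm (g n ?w) \<le> G'" for n by (rule G')
    have "summable (\<lambda>n. e n * (of_real x ^ n * g n ?w))"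
    proof (rule summable_comparison_test')
      show "summable (\<lambda>n. E * (x ^ n * G'))"
        by (intro summable_mult summable_mult2 summable_geometric) (use x in auto)
      show "norm (e n * (of_real x ^ n * g n ?w)) \<le> E * (x ^ n * G')" for n
        unfolding norm_mult norm_power norm_of_real using x E0 by (intro mult_mono E G) auto
    qed
    then show ?thesis by (rule suminf_mult)
  qed
  ultimately show ?thesis
    unfolding coef w by simp
qed

text \<open>Identities known for \<open>x < 1\<close> are pushed to \<open>x = 1\<close> along two
  paths in the unit square which meet at the corner \<open>(1, 1)\<close>.\<close>

lemma KdF_eq_hypergeometric_half:
  assumes conv: "KdF_converges [\<alpha>] [a] [b, 1 + \<alpha> / 2, d] [\<beta>] [] [\<alpha> / 2, c] (-1) (-1)"
  shows "KdF [\<alpha>] [a] [b, 1 + \<alpha> / 2, d] [\<beta>] [] [\<alpha> / 2, c] (-1) (-1)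
    = Gamma c * (2 powr (- \<alpha>) * reg_hyp_half b (1 + \<alpha>) c)"
proof -
  have "summable (\<lambda>n. kdf_summand 0 n)" using conv by (auto simp: KdF_converges_def)
  \<comment> \<open>The only row whose convergence is used: all others follow by bounded variation
    of \<open>h\<close> in \<open>n\<close>.\<close>
  then have e: "summable e" by (simp add: kdf_summand_eq h_def)
  have S: "summable (\<lambda>m. \<Sum>n. kdf_summand m n)" using conv by (auto simp: KdF_converges_def)
  obtain V where V: "\<And>n m. norm (h n m) \<le> V m" "\<And>N m. (\<Sum>n<N. norm (h (Suc n) m - h n m)) \<le> V m"
    by (rule h_variation) blast
  have "(\<lambda>n. e n * h n m) sums (\<Sum>n. e n * h n m)" for m
    using uniform_limit_bounded_variation[OF e, of "{0::nat}" "\<lambda>n _. h n m" "V m"] V by (simp add: sums_def)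
  then have "(\<lambda>n. kdf_summand m n) sums ((-1) ^ m * (\<Sum>n. e n * h n m))" for m
    unfolding kdf_summand_eq by (rule sums_mult)
  then have Sm: "(\<Sum>n. kdf_summand m n) = (-1) ^ m * (\<Sum>n. e n * h n m)" for m
    by (simp add: sums_iff)
  let ?w = "\<lambda>x::real. of_real x / (1 + of_real x) :: complex"
  have ne: "1 + complex_of_real x \<noteq> 0" if "0 \<le> x" for x
    using that by (simp add: complex_eq_iff)
  have ne2: "1 + complex_of_real x \<notin> \<real>\<^sub>\<le>\<^sub>0" if "0 \<le> x" for x
    using that by (simp add: complex_nonpos_Reals_iff)
  have powr: "continuous_on {0..1} (\<lambda>x::real. (1 + of_real x :: complex) powr s)" for s
    by (intro continuous_intros) (use ne ne2 in auto)
  \<comment> \<open>\<open>?A\<close> is the Abel sum of the iterated series and \<open>?B\<close>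
    its transform along the edge \<open>y = 1\<close>; \<open>?C\<close> is the same transform along
    the diagonal \<open>y = x\<close> and \<open>?D\<close> its hypergeometric value. Hence
    \<open>?B 1\<close> and \<open>?C 1\<close> coincide literally.\<close>
  let ?A = "\<lambda>x::real. \<Sum>m. (\<Sum>n. kdf_summand m n) * of_real x ^ m"
  let ?B = "\<lambda>x::real. (1 + of_real x) powr (- a) * (\<Sum>n. e n * (of_real 1 ^ n * g n (?w x)))"
  let ?C = "\<lambda>x::real. (1 + of_real x) powr (- a) * (\<Sum>n. e n * (of_real x ^ n * g n (?w x)))"
  let ?D = "\<lambda>x::real. (1 + of_real x) powr (- \<alpha>) * (\<Sum>q. pochhammer b q * pochhammer (1 + \<alpha>) q / (pochhammer c q * fact q) * ?w x ^ q)"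
  have cA: "continuous_on {0..1} ?A" by (rule continuous_on_Abel_sum[OF S])
  have cB: "continuous_on {0..1} ?B"
  proof (rule continuous_on_mult[OF powr])
    have "continuous_on {0..1} (\<lambda>x::real. (x, 1::real))"
      by (intro continuous_intros)
    moreover have "(\<lambda>x::real. (x, 1::real)) ` {0..1} \<subseteq> {0..1} \<times> {0..1}"
      by auto
    ultimately have "continuous_on {0..1} (\<lambda>x. case (x, 1::real) of (x, y) \<Rightarrow> \<Sum>n. e n * (of_real y ^ n * g n (?w x)))"
      by (rule continuous_on_compose2[OF weighted_g_continuous[OF e]])
    then show "continuous_on {0..1} (\<lambda>x. \<Sum>n. e n * (of_real 1 ^ n * g n (?w x)))"
      by simp
  qed
  have cC: "continuous_on {0..1} ?C"
  proof (rule continuous_on_mult[OF powr])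
    have "continuous_on {0..1} (\<lambda>x::real. (x, x))"
      by (intro continuous_intros)
    moreover have "(\<lambda>x::real. (x, x)) ` {0..1} \<subseteq> {0..1} \<times> {0..1}"
      by auto
    ultimately have "continuous_on {0..1} (\<lambda>x. case (x, x) of (x, y) \<Rightarrow> \<Sum>n. e n * (of_real y ^ n * g n (?w x)))"
      by (rule continuous_on_compose2[OF weighted_g_continuous[OF e]])
    then show "continuous_on {0..1} (\<lambda>x. \<Sum>n. e n * (of_real x ^ n * g n (?w x)))"
      by simp
  qed
  have cD: "continuous_on {0..1} ?D"
  proof (rule continuous_on_mult[OF powr])
    have "isCont (\<lambda>u. \<Sum>q. pochhammer b q * pochhammer (1 + \<alpha>) q / (pochhammer c q * fact q) * u ^ q) u"
      if "norm u \<le> 1/2" for u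
    proof (rule isCont_powser[of _ "3/4"])
      show "summable (\<lambda>q. pochhammer b q * pochhammer (1 + \<alpha>) q / (pochhammer c q * fact q) * (3/4) ^ q)"
        by (rule summable_norm_cancel[OF summable_norm_hypergeometric[OF c]]) (simp add: norm_divide)
    qed (use that in \<open>simp add: norm_divide\<close>)
    then have "continuous_on (cball 0 (1/2)) (\<lambda>u. \<Sum>q. pochhammer b q * pochhammer (1 + \<alpha>) q / (pochhammer c q * fact q) * u ^ q)"
      by (intro continuous_at_imp_continuous_on) auto
    then show "continuous_on {0..1} (\<lambda>x. \<Sum>q. pochhammer b q * pochhammer (1 + \<alpha>) q / (pochhammer c q * fact q) * ?w x ^ q)"
    proof (rule continuous_on_compose2)
      show "continuous_on {0..1} ?w" by (intro continuous_intros) (use ne in auto)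
      show "?w ` {0..1} \<subseteq> cball 0 (1/2)"
        using norm_divide_one_plus_le_half by auto
    qed
  qed
  have AB: "?A 1 = ?B 1"
  proof (rule continuous_on_unit_interval_eq_at_1[OF cA cB])
    fix x :: real assume x: "0 \<le> x" "x < 1"
    have "?A x = (\<Sum>m. (\<Sum>n. e n * h n m) * (- of_real x) ^ m)"
      unfolding Sm power_minus[of "of_real x"] by (simp add: mult_ac)
    also have "\<dots> = ?B x" using iterated_sum[OF e x] by simp
    finally show "?A x = ?B x" .
  qed
  have BC: "?B 1 = ?C 1" by simp
  have CD: "?C 1 = ?D 1"
    by (rule continuous_on_unit_interval_eq_at_1[OF cC cD]) (rule diagonal_sum[OF e])
  have "?D 1 = 2 powr (- \<alpha>) * (Gamma c * reg_hyp_half b (1 + \<alpha>) c)"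
    using c by (simp add: reg_hyp_half_eq_hypergeometric[OF c] rGamma_inverse_Gamma Gamma_eq_zero_iff)
  with AB BC CD have "?A 1 = 2 powr (- \<alpha>) * (Gamma c * reg_hyp_half b (1 + \<alpha>) c)"
    by (simp only:)
  then show ?thesis
    by (simp add: KdF_def mult_ac)
qed

end

section \<open>Evaluation of both families by combining the reduction with the contiguous
  sums\<close>

theorem theorem5:
  fixes i :: nat and \<alpha> \<beta> :: complex
  assumes "\<beta> \<notin> \<int>\<^sub>\<le>\<^sub>0" and "\<alpha> / 2 \<notin> \<int>\<^sub>\<le>\<^sub>0" and "1 + (\<alpha> + \<beta>) / 2 \<notin> \<int>\<^sub>\<le>\<^sub>0"
  shows
   "(KdF_converges [\<alpha>] [\<alpha> + \<beta> - of_nat i] [of_nat i - \<alpha>, 1 + \<alpha> / 2, (\<alpha> - \<beta>) / 2]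
                   [\<beta>] [] [\<alpha> / 2, 1 + (\<alpha> + \<beta>) / 2] (-1) (-1) \<and>
     - \<alpha> \<notin> \<int>\<^sub>\<le>\<^sub>0 \<and> of_nat i - \<alpha> \<notin> \<int>\<^sub>\<le>\<^sub>0 \<and>
     \<beta> / 2 + 3 * \<alpha> / 2 - of_nat i + 1 \<notin> \<int>\<^sub>\<le>\<^sub>0 \<and>
     (\<forall>r\<le>i. \<beta> / 4 + 3 * \<alpha> / 4 + (of_nat r + 1 - of_nat i) / 2 \<notin> \<int>\<^sub>\<le>\<^sub>0 \<and>
             \<beta> / 4 - \<alpha> / 4 + (of_nat r + 1 - of_nat i) / 2 \<notin> \<int>\<^sub>\<le>\<^sub>0)
     \<longrightarrow>
     KdF [\<alpha>] [\<alpha> + \<beta> - of_nat i] [of_nat i - \<alpha>, 1 + \<alpha> / 2, (\<alpha> - \<beta>) / 2]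
         [\<beta>] [] [\<alpha> / 2, 1 + (\<alpha> + \<beta>) / 2] (-1) (-1)
     = Gamma (- \<alpha>) * Gamma (1 + (\<alpha> + \<beta>) / 2) /
       (Gamma (of_nat i - \<alpha>) * Gamma (\<beta> / 2 + 3 * \<alpha> / 2 - of_nat i + 1)) *
       (\<Sum>r=0..i. (-1) ^ r * of_nat (i choose r) *
          Gamma (\<beta> / 4 + 3 * \<alpha> / 4 + (of_nat r + 1 - of_nat i) / 2) /
          Gamma (\<beta> / 4 - \<alpha> / 4 + (of_nat r + 1 - of_nat i) / 2)))
    \<and>
    (KdF_converges [\<alpha>] [\<alpha> + \<beta> + of_nat i] [- \<alpha> - of_nat i, 1 + \<alpha> / 2, (\<alpha> - \<beta>) / 2]
                   [\<beta>] [] [\<alpha> / 2, 1 + (\<alpha> + \<beta>) / 2] (-1) (-1) \<and>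
     \<beta> / 2 + 3 * \<alpha> / 2 + of_nat i + 1 \<notin> \<int>\<^sub>\<le>\<^sub>0 \<and>
     (\<forall>r\<le>i. \<beta> / 4 + 3 * \<alpha> / 4 + (of_nat r + 1 + of_nat i) / 2 \<notin> \<int>\<^sub>\<le>\<^sub>0 \<and>
             \<beta> / 4 - \<alpha> / 4 + (of_nat r + 1 - of_nat i) / 2 \<notin> \<int>\<^sub>\<le>\<^sub>0)
     \<longrightarrow>
     KdF [\<alpha>] [\<alpha> + \<beta> + of_nat i] [- \<alpha> - of_nat i, 1 + \<alpha> / 2, (\<alpha> - \<beta>) / 2]
         [\<beta>] [] [\<alpha> / 2, 1 + (\<alpha> + \<beta>) / 2] (-1) (-1)
     = Gamma (1 + (\<alpha> + \<beta>) / 2) / Gamma (\<beta> / 2 + 3 * \<alpha> / 2 + of_nat i + 1) *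
       (\<Sum>r=0..i. of_nat (i choose r) *
          Gamma (\<beta> / 4 + 3 * \<alpha> / 4 + (of_nat r + 1 + of_nat i) / 2) /
          Gamma (\<beta> / 4 - \<alpha> / 4 + (of_nat r + 1 - of_nat i) / 2)))"
proof (intro conjI impI; elim conjE)
  define c where "c = 1 + (\<alpha> + \<beta>) / 2"
  assume conv: "KdF_converges [\<alpha>] [\<alpha> + \<beta> - of_nat i] [of_nat i - \<alpha>, 1 + \<alpha> / 2, (\<alpha> - \<beta>) / 2]
                   [\<beta>] [] [\<alpha> / 2, 1 + (\<alpha> + \<beta>) / 2] (-1) (-1)"
    and np: "- \<alpha> \<notin> \<int>\<^sub>\<le>\<^sub>0" "of_nat i - \<alpha> \<notin> \<int>\<^sub>\<le>\<^sub>0"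
    and nr: "\<forall>r\<le>i. \<beta> / 4 + 3 * \<alpha> / 4 + (of_nat r + 1 - of_nat i) / 2 \<notin> \<int>\<^sub>\<le>\<^sub>0 \<and>
             \<beta> / 4 - \<alpha> / 4 + (of_nat r + 1 - of_nat i) / 2 \<notin> \<int>\<^sub>\<le>\<^sub>0"
  let ?K = "KdF [\<alpha>] [\<alpha> + \<beta> - of_nat i] [of_nat i - \<alpha>, 1 + \<alpha> / 2, (\<alpha> - \<beta>) / 2]
         [\<beta>] [] [\<alpha> / 2, 1 + (\<alpha> + \<beta>) / 2] (-1) (-1)"
  have 1: "(c + \<alpha> - of_nat i + of_nat r) / 2 = \<beta> / 4 + 3 * \<alpha> / 4 + (of_nat r + 1 - of_nat i) / 2"
    "(c - \<alpha> - of_nat i + of_nat r) / 2 = \<beta> / 4 - \<alpha> / 4 + (of_nat r + 1 - of_nat i) / 2"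
    "c + \<alpha> - of_nat i = \<beta> / 2 + 3 * \<alpha> / 2 - of_nat i + 1" for r
    by (simp_all add: c_def field_simps)
  \<comment> \<open>Matches the \<open>m\<close>-parameter with \<open>a = \<beta> - b\<close> for
    the choice \<open>b = i - \<alpha>\<close>.\<close>
  have 2: "\<alpha> + \<beta> - of_nat i = \<beta> - (of_nat i - \<alpha>)" by simp
  have "?K = Gamma c * (2 powr (- \<alpha>) * reg_hyp_half (of_nat i - \<alpha>) (1 + \<alpha>) c)"
    using well_poised_kdf.KdF_eq_hypergeometric_half[OF well_poised_kdf.intro[OF assms], of "of_nat i - \<alpha>"] conv unfolding 2 c_def by blast
  then have "pochhammer (- \<alpha>) i * ?K = Gamma c * (2 powr (- \<alpha>) * pochhammer (- \<alpha>) i * reg_hyp_half (of_nat i - \<alpha>) (1 + \<alpha>) c)"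
    by simp
  also have "\<dots> = Gamma c * (rGamma (c + \<alpha> - of_nat i) * (\<Sum>r\<le>i. of_nat (i choose r) *
      ((-1) ^ r * Gamma ((c + \<alpha> - of_nat i + of_nat r) / 2) * rGamma ((c - \<alpha> - of_nat i + of_nat r) / 2))))"
    by (subst reg_hyp_half_contiguous_up) (unfold 1(1,2), use nr in blast, rule refl)
  finally have eq: "pochhammer (- \<alpha>) i * ?K = Gamma c * (rGamma (c + \<alpha> - of_nat i) * (\<Sum>r\<le>i. of_nat (i choose r) *
      ((-1) ^ r * Gamma ((c + \<alpha> - of_nat i + of_nat r) / 2) * rGamma ((c - \<alpha> - of_nat i + of_nat r) / 2))))" .
  \<comment> \<open>The contiguous sum determines only the multiple of the series by
    \<open>pochhammer (- \<alpha>) i\<close>; dividing by this nonzero quotient of Gamma values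
    yields the prefactor of the first formula.\<close>
  have "pochhammer (- \<alpha>) i = Gamma (of_nat i - \<alpha>) / Gamma (- \<alpha>)"
    using pochhammer_Gamma[OF np(1), of i] by simp
  moreover have "Gamma (of_nat i - \<alpha>) \<noteq> 0" "Gamma (- \<alpha>) \<noteq> 0"
    using np by (auto simp: Gamma_eq_zero_iff)
  ultimately have "?K = Gamma (- \<alpha>) / Gamma (of_nat i - \<alpha>) * (pochhammer (- \<alpha>) i * ?K)"
    by simp
  then have K: "?K = Gamma (- \<alpha>) / Gamma (of_nat i - \<alpha>) * (Gamma c * (rGamma (c + \<alpha> - of_nat i) * (\<Sum>r\<le>i. of_nat (i choose r) *
      ((-1) ^ r * Gamma ((c + \<alpha> - of_nat i + of_nat r) / 2) * rGamma ((c - \<alpha> - of_nat i + of_nat r) / 2)))))"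
    unfolding eq .
  show "?K = Gamma (- \<alpha>) * Gamma (1 + (\<alpha> + \<beta>) / 2) /
       (Gamma (of_nat i - \<alpha>) * Gamma (\<beta> / 2 + 3 * \<alpha> / 2 - of_nat i + 1)) *
       (\<Sum>r=0..i. (-1) ^ r * of_nat (i choose r) *
          Gamma (\<beta> / 4 + 3 * \<alpha> / 4 + (of_nat r + 1 - of_nat i) / 2) /
          Gamma (\<beta> / 4 - \<alpha> / 4 + (of_nat r + 1 - of_nat i) / 2))"
    unfolding K unfolding 1(1,2) unfolding 1(3) rGamma_inverse_Gamma c_def[symmetric] atLeast0AtMost
    by (simp only: divide_inverse inverse_mult_distrib mult_ac)
next
  define c where "c = 1 + (\<alpha> + \<beta>) / 2"
  assume conv: "KdF_converges [\<alpha>] [\<alpha> + \<beta> + of_nat i] [- \<alpha> - of_nat i, 1 + \<alpha> / 2, (\<alpha> - \<beta>) / 2]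
                   [\<beta>] [] [\<alpha> / 2, 1 + (\<alpha> + \<beta>) / 2] (-1) (-1)"
    and nr: "\<forall>r\<le>i. \<beta> / 4 + 3 * \<alpha> / 4 + (of_nat r + 1 + of_nat i) / 2 \<notin> \<int>\<^sub>\<le>\<^sub>0 \<and>
             \<beta> / 4 - \<alpha> / 4 + (of_nat r + 1 - of_nat i) / 2 \<notin> \<int>\<^sub>\<le>\<^sub>0"
  let ?K = "KdF [\<alpha>] [\<alpha> + \<beta> + of_nat i] [- \<alpha> - of_nat i, 1 + \<alpha> / 2, (\<alpha> - \<beta>) / 2]
         [\<beta>] [] [\<alpha> / 2, 1 + (\<alpha> + \<beta>) / 2] (-1) (-1)"
  have 1: "(c + \<alpha> + of_nat r + of_nat i) / 2 = \<beta> / 4 + 3 * \<alpha> / 4 + (of_nat r + 1 + of_nat i) / 2"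
    "(c - \<alpha> + of_nat r - of_nat i) / 2 = \<beta> / 4 - \<alpha> / 4 + (of_nat r + 1 - of_nat i) / 2"
    "c + \<alpha> + of_nat i = \<beta> / 2 + 3 * \<alpha> / 2 + of_nat i + 1" for r
    by (simp_all add: c_def field_simps)
  have 2: "\<alpha> + \<beta> + of_nat i = \<beta> - (- \<alpha> - of_nat i)" by simp
  have "?K = Gamma c * (2 powr (- \<alpha>) * reg_hyp_half (- \<alpha> - of_nat i) (1 + \<alpha>) c)"
    using well_poised_kdf.KdF_eq_hypergeometric_half[OF well_poised_kdf.intro[OF assms], of "- \<alpha> - of_nat i"] conv unfolding 2 c_def by blast
  also have "\<dots> = Gamma c * (rGamma (c + \<alpha> + of_nat i) * (\<Sum>r\<le>i. of_nat (i choose r) *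
      (Gamma ((c + \<alpha> + of_nat r + of_nat i) / 2) * rGamma ((c - \<alpha> + of_nat r - of_nat i) / 2))))"
    by (subst reg_hyp_half_contiguous_down) (unfold 1(1,2), use nr in blast, rule refl)
  finally show "?K = Gamma (1 + (\<alpha> + \<beta>) / 2) / Gamma (\<beta> / 2 + 3 * \<alpha> / 2 + of_nat i + 1) *
       (\<Sum>r=0..i. of_nat (i choose r) *
          Gamma (\<beta> / 4 + 3 * \<alpha> / 4 + (of_nat r + 1 + of_nat i) / 2) /
          Gamma (\<beta> / 4 - \<alpha> / 4 + (of_nat r + 1 - of_nat i) / 2))"
    unfolding 1 rGamma_inverse_Gamma c_def[symmetric] atLeast0AtMost
    by (simp only: divide_inverse mult_ac)
qed

end
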